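(* Let $T\colon H\to H$ be a nonexpansive operator such that $\operatorname{Fix}T\ne\varnothing$ and let $x_0\in L^2(\Omega,\mathcal F,\mathbb P;H)$. For every $n\in\mathbb N$, take $e_n\in L^2(\Omega,\mathcal F,\mathbb P;H)$ and $\mu_n\in L^\infty(\Omega,\mathcal F,\mathbb P;\,]0,1[)$, and set $$x_{n+1}=x_n+\mu_n\big(Tx_n+e_n-x_n\big).$$ For every $n\in\mathbb N$, set $\Phi_n=\{x_0,\dots,x_n\}$ and $\mathcal X_n=\sigma(\Phi_n)$. Suppose that $\sum_{n\in\mathbb N}\mathsf E(\mu_n(1-\mu_n))=+\infty$ and that, for every $n\in\mathbb N$, $\mu_n$ is independent of $\sigma(\{e_n\}\cup\Phi_n)$. Then the following hold for some $\operatorname{Fix}T$-valued random variable $x$: (i) Suppose that $\mathsf E(\|e_n\|^2|\mathcal X_n)\to0$ a.s. and $\sum_{n\in\mathbb N}\mathsf E\mu_n\sqrt{\mathsf E(\|e_n\|^2|\mathcal X_n)}<+\infty$ a.s. Then: (a) $(Tx_n-x_n)_{n\in\mathbb N}$ converges strongly a.s. to $0$. (b) $(x_n)_{n\in\mathbb N}$ converges weakly a.s. to $x$. (c) Suppose that $T-\mathrm{Id}$ is demiregular at every point in $\operatorname{Fix}T$. Then $(x_n)_{n\in\mathbb N}$ converges strongly a.s. to $x$. (ii) Suppose that $\mathsf E\|e_n\|^2\to0$ and $\sum_{n\in\mathbb N}\sqrt{\mathsf E\mu_n^2\,\mathsf E\|e_n\|^2}<+\infty$. Then: (a) $(Tx_n-x_n)_{n\in\mathbb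 N}$ converges strongly in $L^1(\Omega,\mathcal F,\mathbb P;H)$ and strongly a.s. to $0$. (b) $x\in L^2(\Omega,\mathcal F,\mathbb P;\operatorname{Fix}T)$ and $(x_n)_{n\in\mathbb N}$ converges weakly in $L^2(\Omega,\mathcal F,\mathbb P;H)$ and weakly a.s. to $x$. (c) Suppose that $T-\mathrm{Id}$ is demiregular at every point in $\operatorname{Fix}T$. Then $(x_n)_{n\in\mathbb N}$ converges strongly in $L^1(\Omega,\mathcal F,\mathbb P;H)$ and strongly a.s. to $x$.
   Context: $H$ is a separable real Hilbert space with norm $\|\cdot\|$ and identity operator $\mathrm{Id}$; $(\Omega,\mathcal F,\mathbb P)$ is a complete probability space with expectation $\mathsf E$; "a.s." means $\mathbb P$-almost surely. $\operatorname{Fix}T=\{\mathsf x\in H: T\mathsf x=\mathsf x\}$. $T$ is nonexpansive if it is $1$-Lipschitzian. An operator $A\colon H\to H$ is demiregular at $\mathsf x\in H$ if, for every sequence $(\mathsf x_n)$ in $H$ such that $\mathsf x_n\rightharpoonup\mathsf x$ (weakly) and $A\mathsf x_n\to A\mathsf x$ (strongly), we have $\mathsf x_n\to\mathsf x$ strongly. $L^p(\Omega,\mathcal F,\mathbb P;H)$ is the space of (classes of a.s. equal) $H$-valued random variables with $\mathsf E\|x\|^p<+\infty$, with norm $(\mathsf E\|x\|^p)^{1/p}$; $L^p(\Omega,\mathcal F,\mathbb P;S)$ is the subset of those with values in the Borel set $S\subset H$ a.s. For $S\subset\mathbb R$, $L^\infty(\Omega,\mathcal F,\mathbb P;S)$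 is the set of essentially bounded real random variables with values in $S$ a.s. $\mathsf E(\cdot|\mathcal X)$ is conditional expectation and $\sigma(\cdot)$ the generated $\sigma$-algebra. Products without parentheses: $\mathsf E\mu_n\sqrt{\cdots}$ means $(\mathsf E\mu_n)\sqrt{\cdots}$, and $\mathsf E\mu_n^2\,\mathsf E\|e_n\|^2$ means $(\mathsf E[\mu_n^2])(\mathsf E[\|e_n\|^2])$. Weak (strong) convergence a.s. means weak (strong) convergence in $H$ of $(x_n(\omega))_n$ for $\mathbb P$-almost every $\omega$. *)

theory Defs
  imports "HOL-Probability.Probability"
begin

definition Fix :: "('a \<Rightarrow> 'a) \<Rightarrow> 'a set" where
  "Fix T = {z. T z = z}"

definition weakly_converges :: "(nat \<Rightarrow> 'a::real_inner) \<Rightarrow> 'a \<Rightarrow> bool" where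
  "weakly_converges X z \<longleftrightarrow> (\<forall>u. (\<lambda>n. X n \<bullet> u) \<longlonglongrightarrow> z \<bullet> u)"

definition demiregular_at :: "('a::real_inner \<Rightarrow> 'a) \<Rightarrow> 'a \<Rightarrow> bool" where
  "demiregular_at A z \<longleftrightarrow>
     (\<forall>X. weakly_converges X z \<and> (\<lambda>n. A (X n)) \<longlonglongrightarrow> A z \<longrightarrow> X \<longlonglongrightarrow> z)"

text \<open>
  Elements of the Lebesgue spaces are represented by measurable functions, not by classes modulo
  almost sure equality; membership, norms and convergence are unaffected by modification on a null set.
\<close>

definition Lp_space ::
    "'w measure \<Rightarrow> real \<Rightarrow> 'a set \<Rightarrow> ('w \<Rightarrow> 'a::{real_normed_vector, second_countable_topology}) set"
  where
  "Lp_space M p S =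
     {f \<in> borel_measurable M. integrable M (\<lambda>\<omega>. norm (f \<omega>) powr p) \<and> (AE \<omega> in M. f \<omega> \<in> S)}"

definition Lp_norm :: "'w measure \<Rightarrow> real \<Rightarrow> ('w \<Rightarrow> 'a::real_normed_vector) \<Rightarrow> real" where
  "Lp_norm M p f = (\<integral>\<omega>. norm (f \<omega>) powr p \<partial>M) powr (1 / p)"

definition Linf_space :: "'w measure \<Rightarrow> real set \<Rightarrow> ('w \<Rightarrow> real) set" where
  "Linf_space M S =
     {f \<in> borel_measurable M. (\<exists>C. AE \<omega> in M. \<bar>f \<omega>\<bar> \<le> C) \<and> (AE \<omega> in M. f \<omega> \<in> S)}"

definition Lp_converges ::
    "'w measure \<Rightarrow> real \<Rightarrow> (nat \<Rightarrow> 'w \<Rightarrow> 'a::{real_normed_vector, second_countable_topology})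
      \<Rightarrow> ('w \<Rightarrow> 'a) \<Rightarrow> bool" where
  "Lp_converges M p X f \<longleftrightarrow>
     (\<forall>n. X n \<in> Lp_space M p UNIV) \<and> f \<in> Lp_space M p UNIV \<and>
     (\<lambda>n. Lp_norm M p (\<lambda>\<omega>. X n \<omega> - f \<omega>)) \<longlonglongrightarrow> 0"

text \<open>Weak convergence in the Hilbert space \<open>L\<^sup>2\<close>, whose inner product is the expectation of the
  pointwise inner product.\<close>

definition L2_weakly_converges ::
    "'w measure \<Rightarrow> (nat \<Rightarrow> 'w \<Rightarrow> 'a::{real_inner, second_countable_topology})
      \<Rightarrow> ('w \<Rightarrow> 'a) \<Rightarrow> bool" where
  "L2_weakly_converges M X f \<longleftrightarrow>
     (\<forall>n. X n \<in> Lp_space M 2 UNIV) \<and> f \<in> Lp_space M 2 UNIV \<and>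
     (\<forall>g \<in> Lp_space M 2 UNIV.
        (\<lambda>n. \<integral>\<omega>. X n \<omega> \<bullet> g \<omega> \<partial>M) \<longlonglongrightarrow> (\<integral>\<omega>. f \<omega> \<bullet> g \<omega> \<partial>M))"

text \<open>The measure carried by \<open>sigma_rv\<close> is the null measure and is irrelevant: only the space and the
  measurable sets matter, since \<open>real_cond_exp\<close> restricts the measure of \<open>M\<close> to the sub-algebra.
  Replacing the variables by a.s. equal ones changes the sets only by null sets.\<close>

definition sigma_rv :: "'w measure \<Rightarrow> ('w \<Rightarrow> 'b::topological_space) set \<Rightarrow> 'w measure" where
  "sigma_rv M \<Phi> = sigma (space M) {f -` B \<inter> space M | f B. f \<in> \<Phi> \<and> B \<in> sets borel}"

end

theory Submission
  imports Defs
begin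

text \<open>
  Fix \<open>z \<in> Fix T\<close> and let \<open>\<beta>\<^sub>n = \<mu>\<^sub>n \<parallel>e\<^sub>n\<parallel>\<close> be the size of the perturbation in step \<open>n\<close>.
  Nonexpansiveness gives three inequalities that hold along every path:
  \<open>\<parallel>x\<^sub>n\<^sub>+\<^sub>1 - z\<parallel> \<le> \<parallel>x\<^sub>n - z\<parallel> + \<beta>\<^sub>n\<close>, next \<open>\<parallel>T x\<^sub>n\<^sub>+\<^sub>1 - x\<^sub>n\<^sub>+\<^sub>1\<parallel> \<le> \<parallel>T x\<^sub>n - x\<^sub>n\<parallel> + 2 \<beta>\<^sub>n\<close>, and an energy inequality in
  which, as long as the iterates stay bounded, \<open>\<mu>\<^sub>n (1 - \<mu>\<^sub>n) \<parallel>T x\<^sub>n - x\<^sub>n\<parallel>\<^sup>2\<close> is at most the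
  decrease of \<open>\<parallel>x\<^sub>n - z\<parallel>\<^sup>2\<close> plus a multiple of \<open>\<beta>\<^sub>n\<close>. So as soon as \<open>\<Sum>\<beta>\<^sub>n < \<infinity>\<close> on a path, both
  \<open>\<parallel>x\<^sub>n - z\<parallel>\<close>, for all fixed points \<open>z\<close> at once, and \<open>\<parallel>T x\<^sub>n - x\<^sub>n\<parallel>\<close> converge on that path.
  Three things remain.

  \<^item> \<^emph>\<open>The errors are summable almost surely.\<close> By independence and Jensen's inequality, the
    conditional expectation of \<open>\<beta>\<^sub>n\<close> given the past is at most \<open>c\<^sub>n = E \<mu>\<^sub>n \<surd>E(\<parallel>e\<^sub>n\<parallel>\<^sup>2|X\<^sub>n)\<close>.
    As \<open>c\<^sub>n\<close> is known from the past, the events \<open>{c\<^sub>0 + \<dots> + c\<^sub>n \<le> C}\<close> may be used to truncate: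
    the expectation of the sum of the \<open>\<beta>\<^sub>n\<close>, each restricted to its event, is at most \<open>C\<close>.
    Letting \<open>C\<close> grow turns \<open>\<Sum>c\<^sub>n < \<infinity>\<close> into \<open>\<Sum>\<beta>\<^sub>n < \<infinity>\<close> without any martingale convergence
    theorem (\<open>AE_suminf_finite_of_conditional_bound\<close>).

  \<^item> \<^emph>\<open>The residual tends to zero.\<close> On the decreasing events where in addition \<open>\<parallel>x\<^sub>j - z\<parallel> \<le> R\<close>
    for all \<open>j \<le> n\<close>, the expected energy inequality telescopes. Since \<open>\<mu>\<^sub>n\<close> is independent of
    the past, the result is a finite bound for a sum whose terms are \<open>E(\<mu>\<^sub>n (1 - \<mu>\<^sub>n))\<close> times
    the truncated expectation of \<open>\<parallel>T x\<^sub>n - x\<^sub>n\<parallel>\<^sup>2\<close>. The deterministic weights have an infinite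
    sum, so the limit of \<open>\<parallel>T x\<^sub>n - x\<^sub>n\<parallel>\<close> is \<open>0\<close> on almost every path (\<open>residual_energy_finite\<close>,
    \<open>residual_tendsto_zero\<close>).

  \<^item> \<^emph>\<open>The iterates converge weakly.\<close> This is again a statement about single paths. A bounded
    sequence has an asymptotic centre, the unique point that minimizes the eventual distance to
    the sequence. If \<open>T x\<^sub>n - x\<^sub>n\<close> tends to \<open>0\<close>, the centre is a fixed point, and because the
    distances to fixed points converge, all subsequences share the same centre, which forces
    weak convergence to it (\<open>Fejer_weakly_converges\<close>). This replaces weak compactness and
    demiclosedness.

  Under a demiregularity hypothesis, strong convergence is immediate from weak convergence and
  the vanishing residual. For the \<open>L\<^sup>p\<close> statements, \<open>\<parallel>\<beta>\<^sub>n\<parallel>\<^sub>2 = \<surd>(E \<mu>\<^sub>n\<^sup>2 E \<parallel>e\<^sub>n\<parallel>\<^sup>2)\<close> by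
  independence, so the second summability hypothesis says that the \<open>L\<^sup>2\<close> norms of the \<open>\<beta>\<^sub>n\<close> are
  summable. It implies the first one, because \<open>E c\<^sub>n\<close> is at most this norm, and it makes
  \<open>\<parallel>x\<^sub>0 - z\<parallel> + \<Sum>\<beta>\<^sub>n\<close> a square integrable bound of all \<open>\<parallel>x\<^sub>n - z\<parallel>\<close>; every \<open>L\<^sup>p\<close> claim then follows
  from its almost sure counterpart by dominated convergence (\<open>conditional_sum_finite\<close>,
  \<open>square_integrable_envelope\<close>).
\<close>

section \<open>Real sequences\<close>

text \<open>
  Subtracting the partial sums of \<open>b\<close> from \<open>a\<close> gives a decreasing sequence that is bounded below.
\<close>

lemma asymptotic_almost_decreasing_converges:
  fixes a b :: "nat \<Rightarrow> real"
  assumes step: "\<And>n. a (Suc n) \<le> a n + b n" and nonneg: "\<And>n. 0 \<le> a n"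
    and b: "summable b" "\<And>n. 0 \<le> b n"
  shows "convergent a"
proof -
  define s where "s n = (\<Sum>k<n. b k)" for n
  have s: "s \<longlonglongrightarrow> suminf b"
    unfolding s_def using b(1) by (simp add: summable_LIMSEQ)
  have "decseq (\<lambda>n. a n - s n)"
    using step by (intro decseq_SucI) (simp add: s_def algebra_simps)
  moreover have "- suminf b \<le> a n - s n" for n
    using nonneg[of n] sum_le_suminf[OF b(1), of "{..<n}"] b(2) by (simp add: s_def)
  ultimately obtain l where "(\<lambda>n. a n - s n) \<longlonglongrightarrow> l"
    using decseq_convergent[of "\<lambda>n. a n - s n" "- suminf b"] by metis
  from tendsto_add[OF this s] show ?thesis
    by (auto simp: convergent_def)
qed

text \<open>
  A nonzero limit of \<open>d\<close> would make the weighted series comparable to the divergent series of the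
  weights.
\<close>

lemma convergent_vanishes_of_weighted_sum:
  fixes w d :: "nat \<Rightarrow> real"
  assumes w: "\<And>n. 0 \<le> w n" "(\<Sum>n. ennreal (w n)) = \<infinity>"
    and fin: "(\<Sum>n. ennreal (w n * (d n)\<^sup>2)) < \<infinity>" and conv: "convergent d"
  shows "d \<longlonglongrightarrow> 0"
proof -
  obtain l where l: "d \<longlonglongrightarrow> l" using conv by (auto simp: convergent_def)
  have "l = 0"
  proof (rule ccontr)
    assume "l \<noteq> 0"
    then have l2: "0 < l\<^sup>2" by simp
    have "(\<lambda>n. (d n)\<^sup>2) \<longlonglongrightarrow> l\<^sup>2" using l by (intro tendsto_intros)
    then have "\<forall>\<^sub>F n in sequentially. l\<^sup>2 / 2 < (d n)\<^sup>2"
      by (rule order_tendstoD) (use l2 in simp)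
    then obtain N where N: "\<And>n. n \<ge> N \<Longrightarrow> l\<^sup>2 / 2 < (d n)\<^sup>2"
      by (auto simp: eventually_sequentially)
    have "summable (\<lambda>n. w n * (d n)\<^sup>2)"
      using fin w(1) by (intro summable_suminf_not_top) auto
    then have "summable (\<lambda>n. 2 / l\<^sup>2 * (w n * (d n)\<^sup>2))"
      by (rule summable_mult)
    moreover have "norm (w n) \<le> 2 / l\<^sup>2 * (w n * (d n)\<^sup>2)" if "n \<ge> N" for n
    proof -
      have "w n * (l\<^sup>2 / 2) \<le> w n * (d n)\<^sup>2"
        using N[OF that] w(1) by (intro mult_left_mono) auto
      then show ?thesis using l2 w(1) by (simp add: field_simps)
    qed
    ultimately have "summable w"
      by (rule summable_comparison_test'[of _ N])
    then have "(\<Sum>n. ennreal (w n)) = ennreal (suminf w)"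
      using w(1) by (intro suminf_ennreal2) auto
    with w(2) show False by simp
  qed
  with l show ?thesis by simp
qed

section \<open>Asymptotic centres and weak convergence\<close>

text \<open>
  This is \<open>limsup \<parallel>X n - z\<parallel>\<close>, written as an infimum of eventual bounds so that it is real-valued and
  every estimate becomes an estimate of eventual bounds.
\<close>

definition asymptotic_radius :: "(nat \<Rightarrow> 'a::real_normed_vector) \<Rightarrow> 'a \<Rightarrow> real" where
  "asymptotic_radius X z = Inf {r. \<forall>\<^sub>F n in sequentially. norm (X n - z) \<le> r}"

lemma eventual_bound_nonneg:
  fixes X :: "nat \<Rightarrow> 'a::real_normed_vector"
  assumes "\<forall>\<^sub>F n in sequentially. norm (X n) \<le> r" shows "0 \<le> r"
  using eventually_happens'[OF sequentially_bot assms] norm_ge_zero order_trans by blast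

lemma asymptotic_radius_le:
  assumes "\<forall>\<^sub>F n in sequentially. norm (X n - z) \<le> r"
  shows "asymptotic_radius X z \<le> r"
  unfolding asymptotic_radius_def
  using assms eventual_bound_nonneg by (intro cInf_lower bdd_belowI[of _ 0]) auto

lemma asymptotic_radius_less:
  assumes "Bseq X" "asymptotic_radius X z < r"
  shows "\<forall>\<^sub>F n in sequentially. norm (X n - z) \<le> r"
proof -
  obtain K where K: "\<And>n. norm (X n) \<le> K"
    using assms(1) by (auto simp: Bseq_def)
  have "norm (X n - z) \<le> K + norm z" for n
    using norm_triangle_ineq4[of "X n" z] K[of n] by linarith
  then have "{r. \<forall>\<^sub>F n in sequentially. norm (X n - z) \<le> r} \<noteq> {}"
    by (auto intro!: exI[of _ "K + norm z"])
  from cInf_lessD[OF this assms(2)[unfolded asymptotic_radius_def]]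
  obtain q where "\<forall>\<^sub>F n in sequentially. norm (X n - z) \<le> q" "q < r" by auto
  then show ?thesis by (elim eventually_mono) auto
qed

lemma asymptotic_radius_nonneg:
  assumes "Bseq X" shows "0 \<le> asymptotic_radius X z"
  by (rule dense_ge) (rule eventual_bound_nonneg[OF asymptotic_radius_less[OF assms]])

lemma asymptotic_radius_eq_limit:
  assumes "(\<lambda>n. norm (X n - z)) \<longlonglongrightarrow> l" "Bseq X"
  shows "asymptotic_radius X z = l"
proof (rule antisym)
  show "asymptotic_radius X z \<le> l"
  proof (rule dense_ge)
    fix r assume "l < r"
    from order_tendstoD(2)[OF assms(1) this] show "asymptotic_radius X z \<le> r"
      by (intro asymptotic_radius_le) (auto elim: eventually_mono)
  qed
  show "l \<le> asymptotic_radius X z"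
  proof (rule dense_ge)
    fix r assume "asymptotic_radius X z < r"
    from asymptotic_radius_less[OF assms(2) this] show "l \<le> r"
      by (rule tendsto_upperbound[OF assms(1)]) simp
  qed
qed

text \<open>
  The parallelogram law: if two points both have radius below \<open>s\<close>, then the square of the radius of
  their midpoint is at most \<open>s\<^sup>2 - \<parallel>a - b\<parallel>\<^sup>2 / 4\<close>, and this must stay above the square of the lower
  bound \<open>m\<close>. Hence almost minimizers of the radius are close to each other.
\<close>

lemma asymptotic_radius_midpoint:
  fixes X :: "nat \<Rightarrow> 'a::real_inner"
  assumes "Bseq X" "asymptotic_radius X a < s" "asymptotic_radius X b < s"
    and "\<And>z. m \<le> asymptotic_radius X z" and "0 \<le> m"
  shows "(norm (a - b))\<^sup>2 \<le> 4 * (s\<^sup>2 - m\<^sup>2)"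
proof -
  define c where "c = (1/2) *\<^sub>R (a + b)"
  define q where "q = s\<^sup>2 - (norm (a - b))\<^sup>2 / 4"
  have ev: "\<forall>\<^sub>F n in sequentially. (norm (X n - c))\<^sup>2 \<le> q"
    using asymptotic_radius_less[OF assms(1,2)] asymptotic_radius_less[OF assms(1,3)]
  proof eventually_elim
    case (elim n)
    have "(norm (X n - c))\<^sup>2
        = (norm (X n - a))\<^sup>2 / 2 + (norm (X n - b))\<^sup>2 / 2 - (norm (a - b))\<^sup>2 / 4"
      unfolding c_def power2_norm_eq_inner
      by (simp add: inner_diff_left inner_diff_right inner_add_left inner_add_right
          inner_commute field_simps)
    moreover have "(norm (X n - a))\<^sup>2 \<le> s\<^sup>2" "(norm (X n - b))\<^sup>2 \<le> s\<^sup>2"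
      using elim by (auto intro: power_mono)
    ultimately show ?case by (simp add: q_def)
  qed
  then have "0 \<le> q"
    using eventually_happens'[OF sequentially_bot ev] by (metis order_trans zero_le_power2)
  have "\<forall>\<^sub>F n in sequentially. norm (X n - c) \<le> sqrt q"
    using ev by eventually_elim (rule real_le_rsqrt)
  then have "m \<le> sqrt q"
    by (rule order_trans[OF assms(4) asymptotic_radius_le])
  then have "m\<^sup>2 \<le> q"
    using \<open>0 \<le> m\<close> \<open>0 \<le> q\<close> by (metis power_mono real_sqrt_pow2)
  then show ?thesis by (simp add: q_def)
qed

text \<open>
  The midpoint estimate makes every minimizing sequence Cauchy. Its limit is a minimizer because the
  radius is \<open>1\<close>-Lipschitz, and the same estimate gives uniqueness.
\<close>

lemma asymptotic_centre_exists:
  fixes X :: "nat \<Rightarrow> 'a::{real_inner, banach}"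
  assumes "Bseq X"
  shows "\<exists>c. \<forall>z. z \<noteq> c \<longrightarrow> asymptotic_radius X c < asymptotic_radius X z"
proof -
  let ?\<rho> = "asymptotic_radius X"
  define m where "m = Inf (range ?\<rho>)"
  have bdd: "bdd_below (range ?\<rho>)"
    using asymptotic_radius_nonneg[OF assms] by (auto intro!: bdd_belowI[of _ 0])
  have m_le: "m \<le> ?\<rho> z" for z
    unfolding m_def using bdd by (rule cInf_lower[rotated]) simp
  have m0: "0 \<le> m"
    unfolding m_def by (rule cInf_greatest) (auto simp: asymptotic_radius_nonneg[OF assms])
  define s where "s k = m + 1 / real (Suc k)" for k
  have "\<exists>z. ?\<rho> z < s k" for k
    using cInf_lessD[of "range ?\<rho>" "s k"] by (auto simp: s_def m_def)
  then obtain c where c: "\<And>k. ?\<rho> (c k) < s k" by metis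
  have s_dec: "s k \<le> s j" if "j \<le> k" for j k
    using that by (simp add: s_def frac_le)
  have s_lim: "(\<lambda>k. 4 * ((s k)\<^sup>2 - m\<^sup>2)) \<longlonglongrightarrow> 4 * ((m + 0)\<^sup>2 - m\<^sup>2)"
    unfolding s_def by (intro tendsto_intros LIMSEQ_Suc[OF lim_1_over_n])
  have "Cauchy c"
  proof (rule metric_CauchyI)
    fix \<epsilon> :: real assume "0 < \<epsilon>"
    then have "\<forall>\<^sub>F k in sequentially. 4 * ((s k)\<^sup>2 - m\<^sup>2) < \<epsilon>\<^sup>2"
      using s_lim by (intro order_tendstoD) auto
    then obtain N where N: "4 * ((s N)\<^sup>2 - m\<^sup>2) < \<epsilon>\<^sup>2"
      by (auto simp: eventually_sequentially)
    have "dist (c i) (c j) < \<epsilon>" if "i \<ge> N" "j \<ge> N" for i j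
    proof -
      have "?\<rho> (c i) < s N" "?\<rho> (c j) < s N"
        using c s_dec that by (meson less_le_trans)+
      from asymptotic_radius_midpoint[OF assms this m_le m0] N
      have "(norm (c i - c j))\<^sup>2 < \<epsilon>\<^sup>2" by simp
      then show ?thesis
        using \<open>0 < \<epsilon>\<close> by (simp add: dist_norm power_less_imp_less_base)
    qed
    then show "\<exists>N. \<forall>i\<ge>N. \<forall>j\<ge>N. dist (c i) (c j) < \<epsilon>" by blast
  qed
  then obtain a where a: "c \<longlonglongrightarrow> a"
    using Cauchy_convergent convergent_def by blast
  have "?\<rho> a \<le> s k + norm (c k - a)" for k
  proof (rule asymptotic_radius_le)
    show "\<forall>\<^sub>F n in sequentially. norm (X n - a) \<le> s k + norm (c k - a)"
      using asymptotic_radius_less[OF assms c[of k]]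
    proof eventually_elim
      case (elim n)
      then show ?case
        using norm_triangle_ineq[of "X n - c k" "c k - a"] by simp
    qed
  qed
  moreover have "(\<lambda>k. s k + norm (c k - a)) \<longlonglongrightarrow> (m + 0) + norm (a - a)"
    unfolding s_def by (intro tendsto_intros LIMSEQ_Suc[OF lim_1_over_n] a)
  ultimately have am: "?\<rho> a \<le> m"
    by (intro tendsto_lowerbound[of "\<lambda>k. s k + norm (c k - a)"]) auto
  have "?\<rho> a < ?\<rho> z" if "z \<noteq> a" for z
  proof (rule ccontr)
    assume "\<not> ?\<rho> a < ?\<rho> z"
    with am have zm: "?\<rho> z \<le> m" by simp
    have "(norm (a - z))\<^sup>2 \<le> 4 * ((s k)\<^sup>2 - m\<^sup>2)" for k
      using am zm by (intro asymptotic_radius_midpoint[OF assms _ _ m_le m0])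
        (auto simp: s_def intro: le_less_trans)
    then have "(norm (a - z))\<^sup>2 \<le> 4 * ((m + 0)\<^sup>2 - m\<^sup>2)"
      using s_lim by (intro tendsto_lowerbound[OF s_lim]) auto
    with that show False by simp
  qed
  then have "\<forall>z. z \<noteq> a \<longrightarrow> ?\<rho> a < ?\<rho> z" by simp
  then show ?thesis by (rule exI)
qed

text \<open>
  Since \<open>X n\<close> and \<open>T (X n)\<close> are asymptotically equal, nonexpansiveness shows that \<open>T c\<close> has a radius
  that is at most that of the centre \<open>c\<close>; uniqueness of the centre gives \<open>T c = c\<close>.
\<close>

lemma asymptotic_centre_fixed:
  fixes T :: "'a::{real_inner, banach} \<Rightarrow> 'a"
  assumes T: "1-lipschitz_on UNIV T" and X: "Bseq X" and reg: "(\<lambda>n. T (X n) - X n) \<longlonglongrightarrow> 0"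
  shows "\<exists>c\<in>Fix T. \<forall>z. asymptotic_radius X c \<le> asymptotic_radius X z"
proof -
  obtain c where c: "\<forall>z. z \<noteq> c \<longrightarrow> asymptotic_radius X c < asymptotic_radius X z"
    using asymptotic_centre_exists[OF X] by (rule exE)
  have "asymptotic_radius X (T c) \<le> asymptotic_radius X c"
  proof (rule dense_ge)
    fix r assume "asymptotic_radius X c < r"
    from dense[OF this] obtain q where q: "asymptotic_radius X c < q" "q < r" by auto
    have "(\<lambda>n. norm (T (X n) - X n)) \<longlonglongrightarrow> 0" using reg by (rule tendsto_norm_zero)
    then have "\<forall>\<^sub>F n in sequentially. norm (T (X n) - X n) < r - q"
      by (rule order_tendstoD) (use q in simp)
    with asymptotic_radius_less[OF X q(1)]
    have "\<forall>\<^sub>F n in sequentially. norm (X n - T c) \<le> r"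
    proof eventually_elim
      case (elim n)
      have "norm (T (X n) - T c) \<le> norm (X n - c)"
        using lipschitz_onD[OF T, of "X n" c] by (simp add: dist_norm)
      then show ?case
        using elim norm_triangle_ineq4[of "T (X n) - T c" "T (X n) - X n"] by simp
    qed
    then show "asymptotic_radius X (T c) \<le> r" by (rule asymptotic_radius_le)
  qed
  then have "T c = c" using c[rule_format, of "T c"] by linarith
  then have "c \<in> Fix T" by (simp add: Fix_def)
  moreover have "\<forall>z. asymptotic_radius X c \<le> asymptotic_radius X z"
  proof
    fix z show "asymptotic_radius X c \<le> asymptotic_radius X z"
      using c[rule_format, of z] by (cases "z = c") auto
  qed
  ultimately show ?thesis by blast
qed

text \<open>
  Opial's theorem. Let \<open>c\<close> be the centre of the whole sequence. A subsequence has a centre in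
  \<open>Fix T\<close> too, and the radius of a fixed point is the same for the subsequence as for the
  sequence, because the distances converge. So \<open>c\<close> also minimizes the radius of every subsequence. If
  \<open>(X n - c) \<bullet> u\<close> stayed above a positive number along a subsequence, moving from \<open>c\<close> a little in
  the direction \<open>u\<close> would decrease the radius of that subsequence.
\<close>

theorem Fejer_weakly_converges:
  fixes T :: "'a::{real_inner, banach} \<Rightarrow> 'a"
  assumes T: "1-lipschitz_on UNIV T" and ne: "Fix T \<noteq> {}"
    and conv: "\<And>z. z \<in> Fix T \<Longrightarrow> convergent (\<lambda>n. norm (X n - z))"
    and reg: "(\<lambda>n. T (X n) - X n) \<longlonglongrightarrow> 0"
  shows "\<exists>c\<in>Fix T. weakly_converges X c"
proof -
  have X: "Bseq X"
  proof -
    obtain z where "z \<in> Fix T" using ne by blast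
    from convergent_imp_Bseq[OF conv[OF this]] have "Bseq (\<lambda>n. X n - z)"
      by (simp add: Bseq_def)
    then show ?thesis using Bseq_add[of "\<lambda>n. X n - z" z] by simp
  qed
  obtain c where c: "c \<in> Fix T" "\<And>z. asymptotic_radius X c \<le> asymptotic_radius X z"
    using asymptotic_centre_fixed[OF T X reg] by blast
  obtain l where l: "(\<lambda>n. norm (X n - c)) \<longlonglongrightarrow> l"
    using conv[OF c(1)] by (auto simp: convergent_def)
  have l0: "0 \<le> l" using l by (rule tendsto_lowerbound) auto
  have one_sided: "\<forall>\<^sub>F n in sequentially. (X n - c) \<bullet> u < \<epsilon>" if "0 < \<epsilon>" for u \<epsilon>
  proof (rule ccontr)
    assume "\<not> ?thesis"
    from not_eventually_sequentiallyD[OF this]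
    obtain r :: "nat \<Rightarrow> nat" where r: "strict_mono r" "\<And>n. \<epsilon> \<le> (X (r n) - c) \<bullet> u"
      by (auto simp: not_less)
    define Y where "Y n = X (r n)" for n
    have Y: "Bseq Y"
      using X by (auto simp: Bseq_def Y_def)
    have lim_Y: "(\<lambda>n. norm (Y n - z)) \<longlonglongrightarrow> k" if "(\<lambda>n. norm (X n - z)) \<longlonglongrightarrow> k" for z k
      using LIMSEQ_subseq_LIMSEQ[OF that r(1)] by (simp add: Y_def o_def)
    have "(\<lambda>n. T (Y n) - Y n) \<longlonglongrightarrow> 0"
      using LIMSEQ_subseq_LIMSEQ[OF reg r(1)] by (simp add: Y_def o_def)
    then obtain d where d: "d \<in> Fix T" "\<And>z. asymptotic_radius Y d \<le> asymptotic_radius Y z"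
      using asymptotic_centre_fixed[OF T Y] by blast
    obtain k where k: "(\<lambda>n. norm (X n - d)) \<longlonglongrightarrow> k"
      using conv[OF d(1)] by (auto simp: convergent_def)
    have "l \<le> k"
      using c(2)[of d] asymptotic_radius_eq_limit[OF l X] asymptotic_radius_eq_limit[OF k X] by simp
    also have "k = asymptotic_radius Y d"
      using asymptotic_radius_eq_limit[OF lim_Y[OF k] Y] by simp
    finally have l_le: "l \<le> asymptotic_radius Y z" for z
      using d(2)[of z] by simp
    have "u \<noteq> 0" using r(2)[of 0] \<open>0 < \<epsilon>\<close> by auto
    then have u: "0 < (norm u)\<^sup>2" by simp
    \<comment> \<open>the minimizer of \<open>t \<mapsto> t\<^sup>2 \<parallel>u\<parallel>\<^sup>2 - 2 t \<epsilon>\<close>, whose minimum is \<open>- \<delta>\<close>\<close>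
    define t where "t = \<epsilon> / (norm u)\<^sup>2"
    define \<delta> where "\<delta> = \<epsilon>\<^sup>2 / (norm u)\<^sup>2"
    have \<delta>: "0 < \<delta>" using u \<open>0 < \<epsilon>\<close> by (simp add: \<delta>_def)
    have "(\<lambda>n. (norm (Y n - c))\<^sup>2) \<longlonglongrightarrow> l\<^sup>2"
      using lim_Y[OF l] by (intro tendsto_intros)
    then have "\<forall>\<^sub>F n in sequentially. (norm (Y n - c))\<^sup>2 < l\<^sup>2 + \<delta> / 2"
      by (rule order_tendstoD) (use \<delta> in simp)
    then have ev: "\<forall>\<^sub>F n in sequentially. (norm (Y n - (c + t *\<^sub>R u)))\<^sup>2 \<le> l\<^sup>2 - \<delta> / 2"
    proof eventually_elim
      case (elim n)
      have "(norm (Y n - (c + t *\<^sub>R u)))\<^sup>2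
          = (norm (Y n - c))\<^sup>2 - 2 * t * ((Y n - c) \<bullet> u) + t\<^sup>2 * (norm u)\<^sup>2"
        unfolding power2_norm_eq_inner
        by (simp add: inner_diff_left inner_diff_right inner_add_left inner_add_right
            inner_commute algebra_simps power2_eq_square)
      also have "t\<^sup>2 * (norm u)\<^sup>2 = \<delta>"
        using u by (simp add: t_def \<delta>_def power2_eq_square)
      also have "2 * t * ((Y n - c) \<bullet> u) \<ge> 2 * t * \<epsilon>"
        using r(2)[of n] \<open>0 < \<epsilon>\<close> by (intro mult_left_mono) (auto simp: Y_def t_def)
      moreover have "2 * t * \<epsilon> = 2 * \<delta>"
        by (simp add: t_def \<delta>_def power2_eq_square)
      ultimately show ?case using elim by linarith
    qed
    then have q0: "0 \<le> l\<^sup>2 - \<delta> / 2"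
      using eventually_happens'[OF sequentially_bot ev] by (metis order_trans zero_le_power2)
    have "asymptotic_radius Y (c + t *\<^sub>R u) \<le> sqrt (l\<^sup>2 - \<delta> / 2)"
      using ev by (intro asymptotic_radius_le) (auto elim: eventually_mono intro: real_le_rsqrt)
    with l_le have "l \<le> sqrt (l\<^sup>2 - \<delta> / 2)" by (meson order_trans)
    then have "l\<^sup>2 \<le> l\<^sup>2 - \<delta> / 2"
      using l0 q0 by (metis power_mono real_sqrt_pow2)
    with \<delta> show False by simp
  qed
  have "(\<lambda>n. (X n - c) \<bullet> u) \<longlonglongrightarrow> 0" for u
  proof (rule order_tendstoI)
    fix a :: real assume "a < 0"
    then show "\<forall>\<^sub>F n in sequentially. a < (X n - c) \<bullet> u"
      using one_sided[of "- a" "- u"] by (auto elim!: eventually_mono)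
  qed (use one_sided in auto)
  then have "weakly_converges X c"
    unfolding weakly_converges_def
    by (auto simp: inner_diff_left LIM_zero_iff)
  with c(1) show ?thesis by blast
qed

section \<open>One step of the perturbed iteration\<close>

lemma KM_step_distance:
  fixes T :: "'a::real_inner \<Rightarrow> 'a"
  assumes T: "1-lipschitz_on UNIV T" and z: "z \<in> Fix T" and m: "0 < m" "m < 1"
  shows "norm (u + m *\<^sub>R (T u + v - u) - z) \<le> norm (u - z) + m * norm v"
proof -
  have "u + m *\<^sub>R (T u + v - u) - z = (1 - m) *\<^sub>R (u - z) + m *\<^sub>R (T u - T z) + m *\<^sub>R v"
    using z by (simp add: Fix_def algebra_simps)
  also have "norm \<dots> \<le> norm ((1 - m) *\<^sub>R (u - z)) + norm (m *\<^sub>R (T u - T z)) + norm (m *\<^sub>R v)"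
    by (intro order_trans[OF norm_triangle_ineq] add_right_mono norm_triangle_ineq)
  also have "\<dots> = (1 - m) * norm (u - z) + m * norm (T u - T z) + m * norm v"
    using m by simp
  also have "m * norm (T u - T z) \<le> m * norm (u - z)"
    using lipschitz_onD[OF T, of u z] m by (intro mult_left_mono) (auto simp: dist_norm)
  finally show ?thesis by (simp add: left_diff_distrib)
qed

text \<open>
  The new residual is at most \<open>\<parallel>T u' - T u\<parallel> + \<parallel>T u - u'\<parallel>\<close>. The unperturbed parts of the two terms are
  the fractions \<open>m\<close> and \<open>1 - m\<close> of the old residual, and the perturbation enters both.
\<close>

lemma KM_step_residual:
  fixes T :: "'a::real_inner \<Rightarrow> 'a"
  assumes T: "1-lipschitz_on UNIV T" and m: "0 < m" "m < 1"
    and u': "u' = u + m *\<^sub>R (T u + v - u)"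
  shows "norm (T u' - u') \<le> norm (T u - u) + 2 * (m * norm v)"
proof -
  have "norm (T u' - T u) \<le> norm (u' - u)"
    using lipschitz_onD[OF T, of u' u] by (simp add: dist_norm)
  also have "u' - u = m *\<^sub>R (T u - u) + m *\<^sub>R v"
    by (simp add: u' algebra_simps)
  also have "norm \<dots> \<le> m * norm (T u - u) + m * norm v"
    using norm_triangle_ineq[of "m *\<^sub>R (T u - u)" "m *\<^sub>R v"] m by simp
  finally have 1: "norm (T u' - T u) \<le> m * norm (T u - u) + m * norm v" .
  have "T u - u' = (1 - m) *\<^sub>R (T u - u) - m *\<^sub>R v"
    by (simp add: u' algebra_simps)
  then have 2: "norm (T u - u') \<le> (1 - m) * norm (T u - u) + m * norm v"
    using norm_triangle_ineq4[of "(1 - m) *\<^sub>R (T u - u)" "m *\<^sub>R v"] m by simp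
  have "norm (T u' - u') \<le> norm (T u' - T u) + norm (T u - u')"
    using norm_triangle_ineq[of "T u' - T u" "T u - u'"] by simp
  with 1 2 show ?thesis by (simp add: algebra_simps)
qed

text \<open>
  For the unperturbed step \<open>y\<close>, the convexity identity for \<open>\<parallel>\<cdot>\<parallel>\<^sup>2\<close> gives
  \<open>\<parallel>y - z\<parallel>\<^sup>2 \<le> \<parallel>u - z\<parallel>\<^sup>2 - m (1 - m) \<parallel>T u - u\<parallel>\<^sup>2\<close>. Passing from \<open>y\<close> to \<open>u'\<close> would cost a term
  quadratic in \<open>v\<close>; cutting the new distance off at \<open>R\<close> makes the cost linear in \<open>m \<parallel>v\<parallel>\<close>, so that
  only first moments of the errors enter later.
\<close>

lemma KM_step_energy:
  fixes T :: "'a::real_inner \<Rightarrow> 'a"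
  assumes T: "1-lipschitz_on UNIV T" and z: "z \<in> Fix T" and m: "0 < m" "m < 1"
    and u': "u' = u + m *\<^sub>R (T u + v - u)" and R: "norm (u - z) \<le> R"
  shows "m * (1 - m) * (norm (T u - u))\<^sup>2
    \<le> (norm (u - z))\<^sup>2 - (min (norm (u' - z)) R)\<^sup>2 + 2 * R * (m * norm v)"
proof -
  define y where "y = u + m *\<^sub>R (T u - u)"
  define q where "q = min (norm (u' - z)) R"
  have R0: "0 \<le> R" using R norm_ge_zero order_trans by blast
  have "(norm (y - z))\<^sup>2 = (1 - m) * (norm (u - z))\<^sup>2 + m * (norm (T u - z))\<^sup>2
      - m * (1 - m) * (norm (T u - u))\<^sup>2"
    unfolding y_def power2_norm_eq_inner
    by (simp add: inner_diff_left inner_diff_right inner_add_left inner_add_right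
        inner_commute algebra_simps)
  moreover have "norm (T u - z) \<le> norm (u - z)"
    using lipschitz_onD[OF T, of u z] z by (simp add: dist_norm Fix_def)
  then have "m * (norm (T u - z))\<^sup>2 \<le> m * (norm (u - z))\<^sup>2"
    using m by (intro mult_left_mono power_mono) auto
  ultimately have y: "(norm (y - z))\<^sup>2 \<le> (norm (u - z))\<^sup>2 - m * (1 - m) * (norm (T u - u))\<^sup>2"
    by (simp add: algebra_simps)
  also have "\<dots> \<le> (norm (u - z))\<^sup>2" using m by simp
  finally have yu: "norm (y - z) \<le> norm (u - z)" by (rule power2_le_imp_le) simp
  have "u' - z = (y - z) + m *\<^sub>R v" by (simp add: u' y_def algebra_simps)
  also have "norm \<dots> \<le> norm (y - z) + m * norm v"
    using norm_triangle_ineq[of "y - z" "m *\<^sub>R v"] m by simp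
  finally have q: "q \<le> norm (y - z) + m * norm v" "q \<le> R" "0 \<le> q"
    using R0 by (auto simp: q_def)
  have "q\<^sup>2 - (norm (y - z))\<^sup>2 = (q - norm (y - z)) * (q + norm (y - z))"
    by (simp add: power2_eq_square algebra_simps)
  also have "\<dots> \<le> (m * norm v) * (2 * R)"
  proof (cases "q \<le> norm (y - z)")
    case True
    then have "(q - norm (y - z)) * (q + norm (y - z)) \<le> 0"
      using q by (intro mult_nonpos_nonneg) auto
    also have "0 \<le> (m * norm v) * (2 * R)" using m R0 by simp
    finally show ?thesis .
  next
    case False
    then show ?thesis using q yu R m by (intro mult_mono) auto
  qed
  finally show ?thesis using y by (simp add: q_def algebra_simps)
qed

section \<open>Measurability of weak limits\<close>

lemma (in complete_measure) borel_measurable_AE_eq: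
  assumes f: "f \<in> borel_measurable M" and eq: "AE \<omega> in M. g \<omega> = f \<omega>"
  shows "g \<in> borel_measurable M"
proof (rule borel_measurableI)
  fix S :: "'b set" assume "open S"
  show "g -` S \<inter> space M \<in> sets M"
  proof (rule in_sets_AE)
    show "f -` S \<inter> space M \<in> sets M"
      using f borel_open[OF \<open>open S\<close>] by (rule measurable_sets)
    show "AE \<omega> in M. (\<omega> \<in> f -` S \<inter> space M) = (\<omega> \<in> g -` S \<inter> space M)"
      using eq by eventually_elim simp
  qed simp
qed

text \<open>
  The norm of \<open>v\<close> is the supremum of the quotients \<open>v \<bullet> u / \<parallel>u\<parallel>\<close> over any dense set of vectors
  \<open>u\<close>, which may be chosen countable. Hence the norm of a weakly
  measurable function is measurable.
\<close>

lemma norm_le_iff_inner_dense: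
  fixes v :: "'a::real_inner"
  assumes D: "\<And>S. open S \<Longrightarrow> S \<noteq> {} \<Longrightarrow> \<exists>u\<in>D. u \<in> S" and r: "0 \<le> r"
  shows "norm v \<le> r \<longleftrightarrow> (\<forall>u\<in>D. v \<bullet> u \<le> r * norm u)"
proof
  assume v: "norm v \<le> r"
  show "\<forall>u\<in>D. v \<bullet> u \<le> r * norm u"
  proof
    fix u
    have "v \<bullet> u \<le> norm v * norm u" by (rule norm_cauchy_schwarz)
    also have "\<dots> \<le> r * norm u" using v by (rule mult_right_mono) simp
    finally show "v \<bullet> u \<le> r * norm u" .
  qed
next
  assume le: "\<forall>u\<in>D. v \<bullet> u \<le> r * norm u"
  let ?U = "{u. r * norm u < v \<bullet> u}"
  have "open ?U" by (intro open_Collect_less continuous_intros)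
  with D[of ?U] le have "v \<notin> ?U" by force
  then have "norm v * norm v \<le> r * norm v"
    by (simp add: power2_norm_eq_inner[symmetric] power2_eq_square)
  then show "norm v \<le> r" using r by (cases "v = 0") auto
qed

text \<open>
  Pettis' theorem for separable inner product spaces: the distances to the points of a countable
  dense set are measurable, and the balls around these points with rational radii generate the
  topology.
\<close>

lemma borel_measurable_weakly:
  fixes f :: "'w \<Rightarrow> 'a::{real_inner, second_countable_topology}"
  assumes weak: "\<And>u. (\<lambda>\<omega>. f \<omega> \<bullet> u) \<in> borel_measurable M"
  shows "f \<in> borel_measurable M"
proof -
  obtain D :: "'a set" where D: "countable D" "\<And>S. open S \<Longrightarrow> S \<noteq> {} \<Longrightarrow> \<exists>u\<in>D. u \<in> S"
    using countable_dense_setE by blast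
  have dist_meas: "(\<lambda>\<omega>. norm (f \<omega> - a)) \<in> borel_measurable M" for a
    unfolding borel_measurable_iff_le
  proof
    fix r :: real
    show "{\<omega> \<in> space M. norm (f \<omega> - a) \<le> r} \<in> sets M"
    proof (cases "0 \<le> r")
      case True
      have "Measurable.pred M (\<lambda>\<omega>. f \<omega> \<bullet> u - a \<bullet> u \<le> r * norm u)" for u
        using weak[of u] by measurable
      then have "Measurable.pred M (\<lambda>\<omega>. \<forall>u\<in>D. (f \<omega> - a) \<bullet> u \<le> r * norm u)"
        using D(1) by (simp add: inner_diff_left pred_intros_countable_bounded)
      then show ?thesis
        using norm_le_iff_inner_dense[OF D(2) True] by (simp add: pred_def)
    next
      case False
      then have "{\<omega> \<in> space M. norm (f \<omega> - a) \<le> r} = {}"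
        using norm_ge_zero order_trans by blast
      then show ?thesis by (simp only: sets.empty_sets)
    qed
  qed
  show ?thesis
  proof (rule borel_measurableI)
    fix S :: "'a set" assume S: "open S"
    define I where "I = {(a, q). a \<in> D \<and> q \<in> \<rat> \<and> ball a q \<subseteq> S}"
    have "I \<subseteq> D \<times> \<rat>" by (auto simp: I_def)
    then have "countable I"
      using D(1) countable_rat by (meson countable_SIGMA countable_subset)
    have "S = (\<Union>(a, q)\<in>I. ball a q)"
    proof
      show "S \<subseteq> (\<Union>(a, q)\<in>I. ball a q)"
      proof
        fix s assume "s \<in> S"
        with S obtain \<epsilon> where \<epsilon>: "0 < \<epsilon>" "ball s \<epsilon> \<subseteq> S" by (auto simp: open_contains_ball)
        obtain a where a: "a \<in> D" "dist s a < \<epsilon> / 2"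
          using D(2)[of "ball s (\<epsilon> / 2)"] \<epsilon>(1) by auto
        obtain q where q: "q \<in> \<rat>" "dist s a < q" "q < \<epsilon> / 2"
          using Rats_dense_in_real[OF a(2)] by blast
        have "ball a q \<subseteq> ball s \<epsilon>"
        proof
          fix t assume "t \<in> ball a q"
          then show "t \<in> ball s \<epsilon>"
            using dist_triangle[of s t a] a q by simp
        qed
        with a q \<epsilon> show "s \<in> (\<Union>(a, q)\<in>I. ball a q)"
          by (auto simp: I_def dist_commute intro!: bexI[of _ "(a, q)"])
      qed
    qed (auto simp: I_def)
    then have "f \<omega> \<in> S \<longleftrightarrow> (\<exists>(a, q)\<in>I. norm (f \<omega> - a) < q)" for \<omega>
      by (simp add: split_beta dist_norm norm_minus_commute)
    then have "f -` S \<inter> space M = (\<Union>(a, q)\<in>I. {\<omega> \<in> space M. norm (f \<omega> - a) < q})"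
      by (auto simp: split_beta)
    also have "\<dots> \<in> sets M"
      using dist_meas \<open>countable I\<close> by (intro sets.countable_UN'') (auto simp: split_beta)
    finally show "f -` S \<inter> space M \<in> sets M" .
  qed
qed

lemma weak_limit_norm_le:
  assumes "weakly_converges X c" "\<And>n. norm (X n) \<le> K"
  shows "norm c \<le> K"
proof (cases "c = 0")
  case True
  then show ?thesis using order_trans[OF norm_ge_zero assms(2)] by simp
next
  case False
  have "X n \<bullet> c \<le> K * norm c" for n
    using norm_cauchy_schwarz[of "X n" c] assms(2)[of n]
    by (meson mult_right_mono norm_ge_zero order_trans)
  moreover have "(\<lambda>n. X n \<bullet> c) \<longlonglongrightarrow> c \<bullet> c"
    using assms(1) by (simp add: weakly_converges_def)
  ultimately have "c \<bullet> c \<le> K * norm c"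
    by (intro tendsto_upperbound[of "\<lambda>n. X n \<bullet> c"]) auto
  then have "norm c * norm c \<le> K * norm c"
    by (simp add: power2_norm_eq_inner[symmetric] power2_eq_square)
  with False show ?thesis by simp
qed

section \<open>Sums of square integrable functions\<close>

lemma ennreal_le_of_power2_le:
  fixes a b :: ennreal
  assumes "a\<^sup>2 \<le> b\<^sup>2" shows "a \<le> b"
proof (rule ccontr)
  assume "\<not> a \<le> b"
  then have "b < a" by simp
  then have "b * b < a * a"
    by (cases a; cases b) (auto simp: ennreal_mult[symmetric] ennreal_less_iff ennreal_mult_top
        ennreal_top_mult less_top intro: mult_strict_mono)
  with assms show False by (simp add: power2_eq_square)
qed

text \<open>
  Minkowski's inequality for infinite sums: expand the square of the sum into a double series and
  apply the Cauchy--Schwarz inequality to each term.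
\<close>

lemma nn_integral_suminf_power2_le:
  fixes f :: "nat \<Rightarrow> 'w \<Rightarrow> ennreal"
  assumes f: "\<And>n. f n \<in> borel_measurable M"
    and s: "\<And>n. (\<integral>\<^sup>+\<omega>. (f n \<omega>)\<^sup>2 \<partial>M) \<le> (s n)\<^sup>2"
  shows "(\<integral>\<^sup>+\<omega>. (\<Sum>n. f n \<omega>)\<^sup>2 \<partial>M) \<le> (\<Sum>n. s n)\<^sup>2"
proof -
  note f[measurable]
  have "(\<integral>\<^sup>+\<omega>. f i \<omega> * f j \<omega> \<partial>M) \<le> s i * s j" for i j
  proof (rule ennreal_le_of_power2_le)
    have "(\<integral>\<^sup>+\<omega>. f i \<omega> * f j \<omega> \<partial>M)\<^sup>2 \<le> (\<integral>\<^sup>+\<omega>. (f i \<omega>)\<^sup>2 \<partial>M) * (\<integral>\<^sup>+\<omega>. (f j \<omega>)\<^sup>2 \<partial>M)"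
      by (rule Cauchy_Schwarz_nn_integral[OF f f])
    also have "\<dots> \<le> (s i)\<^sup>2 * (s j)\<^sup>2" by (intro mult_mono s) auto
    finally show "(\<integral>\<^sup>+\<omega>. f i \<omega> * f j \<omega> \<partial>M)\<^sup>2 \<le> (s i * s j)\<^sup>2"
      by (simp add: power_mult_distrib)
  qed
  then have "(\<Sum>i. \<Sum>j. \<integral>\<^sup>+\<omega>. f i \<omega> * f j \<omega> \<partial>M) \<le> (\<Sum>i. \<Sum>j. s i * s j)"
    by (intro suminf_le summableI) auto
  also have "(\<Sum>i. \<Sum>j. \<integral>\<^sup>+\<omega>. f i \<omega> * f j \<omega> \<partial>M) = (\<integral>\<^sup>+\<omega>. (\<Sum>i. \<Sum>j. f i \<omega> * f j \<omega>) \<partial>M)"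
    by (subst nn_integral_suminf, simp)+ simp
  finally show ?thesis by (simp add: power2_eq_square)
qed

section \<open>Sums with summable conditional expectations\<close>

text \<open>
  Let \<open>f n\<close> be dominated by \<open>g n\<close> in conditional expectation given \<open>F n\<close>. The event that
  \<open>g 0 + \<dots> + g n\<close> is at most \<open>C\<close> belongs to \<open>F n\<close>, so on it \<open>f n\<close> may be replaced by \<open>g n\<close> under the
  integral. The truncated \<open>g n\<close> have a sum of at most \<open>C\<close>, as they vanish once the partial sums of the
  \<open>g n\<close> have passed \<open>C\<close>.
\<close>

lemma nn_integral_truncated_sum_le:
  fixes f g :: "nat \<Rightarrow> 'w \<Rightarrow> ennreal" and C :: ennreal
  assumes F: "\<And>n. subalgebra M (F n)" "\<And>m n. m \<le> n \<Longrightarrow> subalgebra (F n) (F m)"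
    and f: "\<And>n. f n \<in> borel_measurable M"
    and g: "\<And>n. g n \<in> borel_measurable (F n)"
    and le: "\<And>n A. A \<in> sets (F n) \<Longrightarrow>
      (\<integral>\<^sup>+\<omega>. f n \<omega> * indicator A \<omega> \<partial>M) \<le> (\<integral>\<^sup>+\<omega>. g n \<omega> * indicator A \<omega> \<partial>M)"
  shows "(\<Sum>n. \<integral>\<^sup>+\<omega>. f n \<omega> * indicator {\<omega>\<in>space M. (\<Sum>k\<le>n. g k \<omega>) \<le> C} \<omega> \<partial>M)
    \<le> C * emeasure M (space M)"
proof -
  define A where "A n = {\<omega>\<in>space M. (\<Sum>k\<le>n. g k \<omega>) \<le> C}" for n
  have gF: "g k \<in> borel_measurable (F n)" if "k \<le> n" for k n
    using measurable_from_subalg[OF F(2)[OF that] g] .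
  have sp: "space (F n) = space M" for n using F(1) by (simp add: subalgebra_def)
  have A: "A n \<in> sets (F n)" for n
  proof -
    have [measurable]: "(\<lambda>\<omega>. \<Sum>k\<le>n. g k \<omega>) \<in> borel_measurable (F n)"
      using gF by (intro borel_measurable_sum) auto
    have "{\<omega>\<in>space (F n). (\<Sum>k\<le>n. g k \<omega>) \<le> C} \<in> sets (F n)" by measurable
    then show ?thesis by (simp add: A_def sp)
  qed
  have gM[measurable]: "g n \<in> borel_measurable M" for n
    using measurable_from_subalg[OF F(1) g] .
  have AM[measurable]: "A n \<in> sets M" for n
    using A F(1) by (auto simp: subalgebra_def)
  have pw: "(\<Sum>k<n. g k \<omega> * indicator (A k) \<omega>) \<le> C" if "\<omega> \<in> space M" for n \<omega>
  proof (induction n)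
    case (Suc n)
    show ?case
    proof (cases "\<omega> \<in> A n")
      case True
      have "(\<Sum>k<Suc n. g k \<omega> * indicator (A k) \<omega>) \<le> (\<Sum>k<Suc n. g k \<omega>)"
        by (intro sum_mono) (auto split: split_indicator)
      also have "\<dots> \<le> C" using True by (simp add: A_def lessThan_Suc_atMost)
      finally show ?thesis .
    qed (use Suc in simp)
  qed simp
  have "(\<Sum>n. \<integral>\<^sup>+\<omega>. f n \<omega> * indicator (A n) \<omega> \<partial>M) \<le> (\<Sum>n. \<integral>\<^sup>+\<omega>. g n \<omega> * indicator (A n) \<omega> \<partial>M)"
    by (intro suminf_le summableI le A)
  also have "\<dots> = (\<integral>\<^sup>+\<omega>. (\<Sum>n. g n \<omega> * indicator (A n) \<omega>) \<partial>M)"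
    by (rule nn_integral_suminf[symmetric]) measurable
  also have "\<dots> \<le> (\<integral>\<^sup>+\<omega>. C \<partial>M)"
    by (intro nn_integral_mono suminf_le_const summableI pw)
  finally show ?thesis by (simp add: A_def)
qed

text \<open>
  Where the sum of the \<open>g n\<close> is below an integer \<open>m\<close>, truncation at level \<open>m\<close> changes nothing; the
  truncated sums of the \<open>f n\<close> have finite integral, and countably many levels \<open>m\<close> suffice.
\<close>

lemma AE_suminf_finite_of_conditional_bound:
  fixes f g :: "nat \<Rightarrow> 'w \<Rightarrow> ennreal"
  assumes "finite_measure M"
    and F: "\<And>n. subalgebra M (F n)" "\<And>m n. m \<le> n \<Longrightarrow> subalgebra (F n) (F m)"
    and f: "\<And>n. f n \<in> borel_measurable M"
    and g: "\<And>n. g n \<in> borel_measurable (F n)"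
    and le: "\<And>n A. A \<in> sets (F n) \<Longrightarrow>
      (\<integral>\<^sup>+\<omega>. f n \<omega> * indicator A \<omega> \<partial>M) \<le> (\<integral>\<^sup>+\<omega>. g n \<omega> * indicator A \<omega> \<partial>M)"
    and fin: "AE \<omega> in M. (\<Sum>n. g n \<omega>) < \<infinity>"
  shows "AE \<omega> in M. (\<Sum>n. f n \<omega>) < \<infinity>"
proof -
  interpret finite_measure M by fact
  define A where "A m n = {\<omega>\<in>space M. (\<Sum>k\<le>n. g k \<omega>) \<le> of_nat m}" for m n :: nat
  note f[measurable]
  have gM[measurable]: "g n \<in> borel_measurable M" for n
    using measurable_from_subalg[OF F(1) g] .
  have [measurable]: "A m n \<in> sets M" for m n unfolding A_def by measurable
  have "AE \<omega> in M. (\<Sum>n. f n \<omega> * indicator (A m n) \<omega>) \<noteq> \<infinity>" for m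
  proof (rule nn_integral_noteq_infinite)
    have "(\<integral>\<^sup>+\<omega>. (\<Sum>n. f n \<omega> * indicator (A m n) \<omega>) \<partial>M)
        = (\<Sum>n. \<integral>\<^sup>+\<omega>. f n \<omega> * indicator (A m n) \<omega> \<partial>M)"
      by (rule nn_integral_suminf) measurable
    also have "\<dots> \<le> of_nat m * emeasure M (space M)"
      unfolding A_def by (rule nn_integral_truncated_sum_le[OF F f g le])
    also have "\<dots> < \<infinity>"
      by (simp add: emeasure_eq_measure ennreal_of_nat_eq_real_of_nat ennreal_mult[symmetric])
    finally show "(\<integral>\<^sup>+\<omega>. (\<Sum>n. f n \<omega> * indicator (A m n) \<omega>) \<partial>M) \<noteq> \<infinity>" by simp
  qed measurable
  then have "AE \<omega> in M. \<forall>m. (\<Sum>n. f n \<omega> * indicator (A m n) \<omega>) \<noteq> \<infinity>"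
    by (simp add: AE_all_countable)
  with fin AE_space show ?thesis
  proof eventually_elim
    case (elim \<omega>)
    then obtain m where m: "(\<Sum>n. g n \<omega>) < of_nat m"
      using ennreal_Ex_less_of_nat by fastforce
    have "\<omega> \<in> A m n" for n
      using sum_le_suminf[OF summableI, of "{..n}" "\<lambda>n. g n \<omega>"] m elim
      by (auto simp: A_def elim intro: order_trans less_imp_le)
    moreover have "(\<Sum>n. f n \<omega> * indicator (A m n) \<omega>) \<noteq> \<infinity>" using elim by blast
    ultimately show ?case by (simp add: less_top[symmetric])
  qed
qed

section \<open>Generated sigma-algebras and independence\<close>

lemma space_sigma_rv [simp]: "space (sigma_rv M \<Phi>) = space M"
  by (simp add: sigma_rv_def space_measure_of_conv)

lemma sets_sigma_rv:
  "sets (sigma_rv M \<Phi>) = sigma_sets (space M) {f -` B \<inter> space M | f B. f \<in> \<Phi> \<and> B \<in> sets borel}"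
  unfolding sigma_rv_def by (rule sets_measure_of) auto

lemma measurable_sigma_rv: "f \<in> \<Phi> \<Longrightarrow> f \<in> borel_measurable (sigma_rv M \<Phi>)"
  by (rule measurableI) (auto simp: sets_sigma_rv)

lemma subalgebra_sigma_rv:
  assumes "space N = space M" "\<And>f. f \<in> \<Phi> \<Longrightarrow> f \<in> borel_measurable N"
  shows "subalgebra N (sigma_rv M \<Phi>)"
proof -
  have "sigma_sets (space N) {f -` B \<inter> space M | f B. f \<in> \<Phi> \<and> B \<in> sets borel} \<subseteq> sets N"
    using assms(1) measurable_sets[OF assms(2)] by (intro sets.sigma_sets_subset) auto
  then show ?thesis
    by (simp add: subalgebra_def sets_sigma_rv assms(1))
qed

lemma (in prob_space) indep_var_of_indep_subalgebras:
  assumes A: "subalgebra M A" "f \<in> borel_measurable A"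
    and B: "subalgebra M B" "g \<in> borel_measurable B"
    and indep: "indep_set (sets A) (sets B)"
  shows "indep_var borel f borel g"
proof -
  have sub: "sigma_sets (space M) {h -` S \<inter> space M | S. S \<in> sets borel} \<subseteq> sets N"
    if "subalgebra M N" "h \<in> borel_measurable N" for N :: "'a measure" and h :: "'a \<Rightarrow> 'x::topological_space"
  proof -
    have "space N = space M" using that(1) by (simp add: subalgebra_def)
    then show ?thesis
      using sets.sigma_sets_subset[of "{h -` S \<inter> space M | S. S \<in> sets borel}" N]
        measurable_sets[OF that(2)] by auto
  qed
  have "indep_set (sigma_sets (space M) {f -` S \<inter> space M | S. S \<in> sets borel})
      (sigma_sets (space M) {g -` S \<inter> space M | S. S \<in> sets borel})"
    using indep sub[OF A, THEN subsetD] sub[OF B, THEN subsetD] unfolding indep_set_def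
    by (elim indep_sets_mono_sets) (auto split: bool.split)
  moreover have "f \<in> borel_measurable M" "g \<in> borel_measurable M"
    using measurable_from_subalg A B by blast+
  ultimately show ?thesis by (simp add: indep_var_eq)
qed

section \<open>Domination in Lebesgue spaces\<close>

lemma (in prob_space) expectation_le_sqrt:
  fixes f :: "'a \<Rightarrow> real"
  assumes f: "f \<in> borel_measurable M" "integrable M (\<lambda>\<omega>. (f \<omega>)\<^sup>2)"
  shows "expectation f \<le> sqrt (expectation (\<lambda>\<omega>. (f \<omega>)\<^sup>2))"
proof (rule real_le_rsqrt)
  have "0 \<le> variance f" by (rule variance_positive)
  then show "(expectation f)\<^sup>2 \<le> expectation (\<lambda>\<omega>. (f \<omega>)\<^sup>2)"
    using variance_eq[OF square_integrable_imp_integrable[OF f] f(2)] by simp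
qed

lemma square_integrable_bound:
  fixes f g :: "'w \<Rightarrow> real" and h :: "'w \<Rightarrow> real"
  assumes "f \<in> borel_measurable M" "integrable M (\<lambda>\<omega>. (g \<omega>)\<^sup>2)" "integrable M (\<lambda>\<omega>. (h \<omega>)\<^sup>2)"
    and "AE \<omega> in M. \<bar>f \<omega>\<bar> \<le> g \<omega> + h \<omega>"
  shows "integrable M (\<lambda>\<omega>. (f \<omega>)\<^sup>2)"
proof (rule Bochner_Integration.integrable_bound)
  show "integrable M (\<lambda>\<omega>. 2 * (g \<omega>)\<^sup>2 + 2 * (h \<omega>)\<^sup>2)" using assms by simp
  show "(\<lambda>\<omega>. (f \<omega>)\<^sup>2) \<in> borel_measurable M" using assms by measurable
  show "AE \<omega> in M. norm ((f \<omega>)\<^sup>2) \<le> norm (2 * (g \<omega>)\<^sup>2 + 2 * (h \<omega>)\<^sup>2)"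
    using assms(4)
  proof eventually_elim
    case (elim \<omega>)
    then have "(f \<omega>)\<^sup>2 \<le> (g \<omega> + h \<omega>)\<^sup>2"
      by (metis abs_ge_zero power2_abs power_mono)
    also have "\<dots> \<le> 2 * (g \<omega>)\<^sup>2 + 2 * (h \<omega>)\<^sup>2"
      using sum_squares_bound[of "g \<omega>" "h \<omega>"] by (simp add: power2_sum)
    finally show ?case by simp
  qed
qed

lemma Lp_space_1I:
  assumes "f \<in> borel_measurable M" "integrable M h" "AE \<omega> in M. norm (f \<omega>) \<le> h \<omega>" "AE \<omega> in M. f \<omega> \<in> S"
  shows "f \<in> Lp_space M 1 S"
proof -
  have "integrable M (\<lambda>\<omega>. norm (f \<omega>))"
    using assms(2) by (rule Bochner_Integration.integrable_bound)
      (use assms in \<open>auto elim: eventually_mono\<close>)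
  then show ?thesis using assms by (simp add: Lp_space_def)
qed

lemma Lp_space_2I:
  assumes "f \<in> borel_measurable M" "integrable M (\<lambda>\<omega>. (h \<omega>)\<^sup>2)" "AE \<omega> in M. norm (f \<omega>) \<le> h \<omega>"
    "AE \<omega> in M. f \<omega> \<in> S"
  shows "f \<in> Lp_space M 2 S"
proof -
  have "integrable M (\<lambda>\<omega>. (norm (f \<omega>))\<^sup>2)"
    using assms(2)
  proof (rule Bochner_Integration.integrable_bound)
    show "AE \<omega> in M. norm ((norm (f \<omega>))\<^sup>2) \<le> norm ((h \<omega>)\<^sup>2)"
      using assms(3) by eventually_elim (auto intro: power_mono)
  qed (use assms(1) in measurable)
  then show ?thesis using assms by (simp add: Lp_space_def)
qed

lemma Lp_converges_1_dominated:
  fixes X :: "nat \<Rightarrow> 'w \<Rightarrow> 'a::{banach, second_countable_topology}"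
  assumes meas: "\<And>n. X n \<in> borel_measurable M" "f \<in> borel_measurable M"
    and h: "integrable M h" "AE \<omega> in M. \<forall>n. norm (X n \<omega>) \<le> h \<omega>"
    and lim: "AE \<omega> in M. (\<lambda>n. X n \<omega>) \<longlonglongrightarrow> f \<omega>"
  shows "Lp_converges M 1 X f"
proof -
  note meas[measurable]
  have h_n: "AE \<omega> in M. norm (X n \<omega>) \<le> h \<omega>" for n
    using h(2) by (rule eventually_mono) simp
  have h_f: "AE \<omega> in M. norm (f \<omega>) \<le> h \<omega>"
    using h(2) lim
  proof eventually_elim
    case (elim \<omega>)
    from tendsto_norm[OF elim(2)] show ?case
      by (rule tendsto_upperbound) (use elim(1) in auto)
  qed
  have "(\<lambda>n. \<integral>\<omega>. norm (X n \<omega> - f \<omega>) \<partial>M) \<longlonglongrightarrow> (\<integral>\<omega>. 0 \<partial>M)"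
  proof (rule integral_dominated_convergence[where w = "\<lambda>\<omega>. 2 * h \<omega>"])
    show "AE \<omega> in M. (\<lambda>n. norm (X n \<omega> - f \<omega>)) \<longlonglongrightarrow> 0"
      using lim by eventually_elim (simp add: LIM_zero tendsto_norm_zero)
    show "AE \<omega> in M. norm (norm (X n \<omega> - f \<omega>)) \<le> 2 * h \<omega>" for n
      using h_n[of n] h_f
    proof eventually_elim
      case (elim \<omega>)
      then show ?case using norm_triangle_ineq4[of "X n \<omega>" "f \<omega>"] by simp
    qed
  qed (use h in auto)
  moreover have "0 \<le> (\<integral>\<omega>. norm (X n \<omega> - f \<omega>) \<partial>M)" for n
    by simp
  ultimately have "(\<lambda>n. Lp_norm M 1 (\<lambda>\<omega>. X n \<omega> - f \<omega>)) \<longlonglongrightarrow> 0"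
    by (simp add: Lp_norm_def)
  moreover have "X n \<in> Lp_space M 1 UNIV" for n
    using h_n by (intro Lp_space_1I[OF meas(1) h(1)]) auto
  moreover have "f \<in> Lp_space M 1 UNIV"
    using h_f by (intro Lp_space_1I[OF meas(2) h(1)]) auto
  ultimately show ?thesis by (simp add: Lp_converges_def)
qed

lemma L2_weakly_converges_dominated:
  fixes X :: "nat \<Rightarrow> 'w \<Rightarrow> 'a::{real_inner, second_countable_topology}"
  assumes meas: "\<And>n. X n \<in> borel_measurable M" "f \<in> borel_measurable M" "h \<in> borel_measurable M"
    and h: "integrable M (\<lambda>\<omega>. (h \<omega>)\<^sup>2)" "AE \<omega> in M. \<forall>n. norm (X n \<omega>) \<le> h \<omega>"
    and lim: "AE \<omega> in M. weakly_converges (\<lambda>n. X n \<omega>) (f \<omega>)"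
  shows "L2_weakly_converges M X f"
proof -
  note meas[measurable]
  have h_n: "AE \<omega> in M. norm (X n \<omega>) \<le> h \<omega>" for n
    using h(2) by (rule eventually_mono) simp
  have h_f: "AE \<omega> in M. norm (f \<omega>) \<le> h \<omega>"
    using h(2) lim by eventually_elim (rule weak_limit_norm_le, auto)
  have "(\<lambda>n. \<integral>\<omega>. X n \<omega> \<bullet> g \<omega> \<partial>M) \<longlonglongrightarrow> (\<integral>\<omega>. f \<omega> \<bullet> g \<omega> \<partial>M)" if g: "g \<in> Lp_space M 2 UNIV" for g
  proof (rule integral_dominated_convergence[where w = "\<lambda>\<omega>. (h \<omega>)\<^sup>2 + (norm (g \<omega>))\<^sup>2"])
    have [measurable]: "g \<in> borel_measurable M" and g2: "integrable M (\<lambda>\<omega>. (norm (g \<omega>))\<^sup>2)"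
      using g by (auto simp: Lp_space_def)
    show "(\<lambda>\<omega>. f \<omega> \<bullet> g \<omega>) \<in> borel_measurable M" "(\<lambda>\<omega>. X n \<omega> \<bullet> g \<omega>) \<in> borel_measurable M" for n
      by measurable
    show "integrable M (\<lambda>\<omega>. (h \<omega>)\<^sup>2 + (norm (g \<omega>))\<^sup>2)" using h(1) g2 by simp
    show "AE \<omega> in M. (\<lambda>n. X n \<omega> \<bullet> g \<omega>) \<longlonglongrightarrow> f \<omega> \<bullet> g \<omega>"
      using lim by eventually_elim (simp add: weakly_converges_def)
    show "AE \<omega> in M. norm (X n \<omega> \<bullet> g \<omega>) \<le> (h \<omega>)\<^sup>2 + (norm (g \<omega>))\<^sup>2" for n
      using h_n[of n]
    proof eventually_elim
      case (elim \<omega>)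
      have "norm (X n \<omega> \<bullet> g \<omega>) \<le> norm (X n \<omega>) * norm (g \<omega>)"
        using Cauchy_Schwarz_ineq2 by simp
      also have "\<dots> \<le> h \<omega> * norm (g \<omega>)" using elim by (rule mult_right_mono) simp
      also have "2 * (h \<omega> * norm (g \<omega>)) \<le> (h \<omega>)\<^sup>2 + (norm (g \<omega>))\<^sup>2"
        using sum_squares_bound[of "h \<omega>" "norm (g \<omega>)"] by simp
      then have "h \<omega> * norm (g \<omega>) \<le> ((h \<omega>)\<^sup>2 + (norm (g \<omega>))\<^sup>2) / 2" by simp
      also have "\<dots> \<le> (h \<omega>)\<^sup>2 + (norm (g \<omega>))\<^sup>2" by simp
      finally show ?case .
    qed
  qed
  moreover have "X n \<in> Lp_space M 2 UNIV" for n
    using h_n by (intro Lp_space_2I[OF meas(1) h(1)]) auto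
  moreover have "f \<in> Lp_space M 2 UNIV"
    using h_f by (intro Lp_space_2I[OF meas(2) h(1)]) auto
  ultimately show ?thesis by (simp add: L2_weakly_converges_def)
qed

section \<open>The random iteration\<close>

locale random_KM = prob_space M + complete_measure M for M :: "'w measure" +
  fixes T :: "'a::{real_inner, banach, second_countable_topology} \<Rightarrow> 'a"
    and x e :: "nat \<Rightarrow> 'w \<Rightarrow> 'a"
    and \<mu> :: "nat \<Rightarrow> 'w \<Rightarrow> real"
  assumes T: "1-lipschitz_on UNIV T"
    and Fix_ne: "Fix T \<noteq> {}"
    and x0_L2: "x 0 \<in> Lp_space M 2 UNIV"
    and e_L2: "\<And>n. e n \<in> Lp_space M 2 UNIV"
    and \<mu>_Linf: "\<And>n. \<mu> n \<in> Linf_space M {0<..<1}"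
    and rec: "\<And>n. AE \<omega> in M. x (Suc n) \<omega> = x n \<omega> + \<mu> n \<omega> *\<^sub>R (T (x n \<omega>) + e n \<omega> - x n \<omega>)"
    and divergent: "(\<Sum>n. ennreal (\<integral>\<omega>. \<mu> n \<omega> * (1 - \<mu> n \<omega>) \<partial>M)) = \<infinity>"
    and indep: "\<And>n. indep_set (sets (sigma_rv M {\<mu> n})) (sets (sigma_rv M ({e n} \<union> x ` {..n})))"
begin

text \<open>
  The history of the iterates, and the history extended by the current error, which is the
  sigma-algebra that \<open>\<mu> n\<close> is independent of.
\<close>

definition past :: "nat \<Rightarrow> 'w measure" where
  "past n = sigma_rv M (x ` {..n})"

definition past_and_error :: "nat \<Rightarrow> 'w measure" where
  "past_and_error n = sigma_rv M ({e n} \<union> x ` {..n})"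

definition step_error :: "nat \<Rightarrow> 'w \<Rightarrow> real" where
  "step_error n \<omega> = \<mu> n \<omega> * norm (e n \<omega>)"

text \<open>
  An upper bound, known from the past, of the conditional expectation of \<open>step_error n\<close> given the
  past.
\<close>

definition predicted_error :: "nat \<Rightarrow> 'w \<Rightarrow> real" where
  "predicted_error n \<omega> = expectation (\<mu> n) * sqrt (real_cond_exp M (past n) (\<lambda>\<omega>. (norm (e n \<omega>))\<^sup>2) \<omega>)"

definition residual :: "nat \<Rightarrow> 'w \<Rightarrow> real" where
  "residual n \<omega> = norm (T (x n \<omega>) - x n \<omega>)"

definition weight :: "nat \<Rightarrow> real" where
  "weight n = expectation (\<lambda>\<omega>. \<mu> n \<omega> * (1 - \<mu> n \<omega>))"

lemma T_measurable [measurable]: "T \<in> borel_measurable borel"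
  using lipschitz_on_continuous_on[OF T] by (rule borel_measurable_continuous_onI)

lemma e_measurable [measurable]: "e n \<in> borel_measurable M"
  using e_L2[of n] by (simp add: Lp_space_def)

lemma \<mu>_measurable [measurable]: "\<mu> n \<in> borel_measurable M"
  using \<mu>_Linf[of n] by (simp add: Linf_space_def)

lemma x_measurable [measurable]: "x n \<in> borel_measurable M"
proof (induction n)
  case 0
  show ?case using x0_L2 by (simp add: Lp_space_def)
next
  case (Suc n)
  note [measurable] = Suc
  show ?case by (rule borel_measurable_AE_eq[OF _ rec]) measurable
qed

lemma step_error_measurable [measurable]: "step_error n \<in> borel_measurable M"
  unfolding step_error_def by measurable

lemma residual_measurable [measurable]: "residual n \<in> borel_measurable M"
  unfolding residual_def by measurable

lemma e_square_integrable: "integrable M (\<lambda>\<omega>. (norm (e n \<omega>))\<^sup>2)"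
  using e_L2[of n] by (simp add: Lp_space_def)

lemma e_integrable: "integrable M (\<lambda>\<omega>. norm (e n \<omega>))"
  by (rule square_integrable_imp_integrable[OF _ e_square_integrable]) measurable

lemma \<mu>_bounds: "AE \<omega> in M. \<forall>n. 0 < \<mu> n \<omega> \<and> \<mu> n \<omega> < 1"
  using \<mu>_Linf by (auto simp: Linf_space_def AE_all_countable)

lemma \<mu>_bounds_at: "AE \<omega> in M. 0 < \<mu> n \<omega> \<and> \<mu> n \<omega> < 1"
  using \<mu>_bounds by (rule eventually_mono) simp

lemma \<mu>_integrable: "integrable M (\<mu> n)"
  using \<mu>_bounds_at[of n] by (intro integrable_const_bound[of _ 1]) (auto elim: eventually_mono)

lemma \<mu>_integrable2: "integrable M (\<lambda>\<omega>. (\<mu> n \<omega>)\<^sup>2)"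
  by (rule integrable_const_bound[where B = 1, OF eventually_mono[OF \<mu>_bounds_at[of n]]])
    (auto intro: power_le_one)

lemma weight_integrable: "integrable M (\<lambda>\<omega>. \<mu> n \<omega> * (1 - \<mu> n \<omega>))"
  using \<mu>_integrable[of n] \<mu>_integrable2[of n] by (simp add: right_diff_distrib power2_eq_square)

lemma weight_nonneg: "0 \<le> weight n"
  unfolding weight_def by (rule integral_nonneg_AE[OF eventually_mono[OF \<mu>_bounds_at[of n]]]) simp

lemma expectation_\<mu>_nonneg: "0 \<le> expectation (\<mu> n)"
  using \<mu>_bounds_at[of n] by (intro integral_nonneg_AE) (auto elim!: eventually_mono)

lemma step_error_nonneg: "AE \<omega> in M. \<forall>n. 0 \<le> step_error n \<omega>"
  using \<mu>_bounds by eventually_elim (simp add: step_error_def less_imp_le)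

lemma subalgebra_past: "subalgebra M (past n)"
  unfolding past_def by (rule subalgebra_sigma_rv) auto

lemma x_measurable_past: "k \<le> n \<Longrightarrow> x k \<in> borel_measurable (past n)"
  unfolding past_def by (rule measurable_sigma_rv) auto

lemma subalgebra_past_mono: "m \<le> n \<Longrightarrow> subalgebra (past n) (past m)"
  using x_measurable_past by (subst (2) past_def, intro subalgebra_sigma_rv) (auto simp: past_def)

lemma predicted_error_measurable_past: "predicted_error n \<in> borel_measurable (past n)"
proof -
  have [measurable]: "real_cond_exp M (past n) (\<lambda>\<omega>. (norm (e n \<omega>))\<^sup>2) \<in> borel_measurable (past n)"
    by (rule borel_measurable_cond_exp)
  show ?thesis unfolding predicted_error_def by measurable
qed

lemma predicted_error_measurable [measurable]: "predicted_error n \<in> borel_measurable M"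
  using measurable_from_subalg[OF subalgebra_past predicted_error_measurable_past] .

lemma indep_integral:
  fixes \<phi> :: "real \<Rightarrow> real"
  assumes \<phi>: "\<phi> \<in> borel_measurable borel" "integrable M (\<lambda>\<omega>. \<phi> (\<mu> n \<omega>))"
    and g: "g \<in> borel_measurable (past_and_error n)" "integrable M g"
  shows "expectation (\<lambda>\<omega>. \<phi> (\<mu> n \<omega>) * g \<omega>) = expectation (\<lambda>\<omega>. \<phi> (\<mu> n \<omega>)) * expectation g"
    and "integrable M (\<lambda>\<omega>. \<phi> (\<mu> n \<omega>) * g \<omega>)"
proof -
  have "(\<lambda>\<omega>. \<phi> (\<mu> n \<omega>)) \<in> borel_measurable (sigma_rv M {\<mu> n})"
    using \<phi>(1) by (rule measurable_compose[rotated]) (simp add: measurable_sigma_rv)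
  then have "indep_var borel (\<lambda>\<omega>. \<phi> (\<mu> n \<omega>)) borel g"
    by (rule indep_var_of_indep_subalgebras[OF _ _ _ g(1) indep[of n, folded past_and_error_def], rotated])
      (auto intro!: subalgebra_sigma_rv simp: past_and_error_def)
  then show "expectation (\<lambda>\<omega>. \<phi> (\<mu> n \<omega>) * g \<omega>) = expectation (\<lambda>\<omega>. \<phi> (\<mu> n \<omega>)) * expectation g"
    and "integrable M (\<lambda>\<omega>. \<phi> (\<mu> n \<omega>) * g \<omega>)"
    using indep_var_lebesgue_integral indep_var_integrable \<phi>(2) g(2) by blast+
qed

lemma subalgebra_joint: "subalgebra (past_and_error n) (past n)"
  unfolding past_def past_and_error_def by (rule subalgebra_sigma_rv) (auto intro: measurable_sigma_rv)

lemma e_measurable_joint: "e n \<in> borel_measurable (past_and_error n)"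
  unfolding past_and_error_def by (rule measurable_sigma_rv) simp

lemma step_error_integrable: "integrable M (step_error n)"
proof -
  note [measurable] = e_measurable_joint
  show ?thesis
    unfolding step_error_def using \<mu>_integrable e_integrable by (intro indep_integral(2)[of "\<lambda>t. t"]) auto
qed

lemma step_error_square:
  "expectation (\<lambda>\<omega>. (step_error n \<omega>)\<^sup>2) = expectation (\<lambda>\<omega>. (\<mu> n \<omega>)\<^sup>2) * expectation (\<lambda>\<omega>. (norm (e n \<omega>))\<^sup>2)"
  "integrable M (\<lambda>\<omega>. (step_error n \<omega>)\<^sup>2)"
proof -
  note [measurable] = e_measurable_joint
  show "expectation (\<lambda>\<omega>. (step_error n \<omega>)\<^sup>2) = expectation (\<lambda>\<omega>. (\<mu> n \<omega>)\<^sup>2) * expectation (\<lambda>\<omega>. (norm (e n \<omega>))\<^sup>2)"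
    and "integrable M (\<lambda>\<omega>. (step_error n \<omega>)\<^sup>2)"
    unfolding step_error_def power_mult_distrib
    by (intro indep_integral[of "\<lambda>t. t\<^sup>2"] \<mu>_integrable2 e_square_integrable; measurable)+
qed

text \<open>
  Independence splits the expectation of \<open>step_error n\<close> on a past event into \<open>expectation (\<mu> n)\<close> and
  the expectation of \<open>\<parallel>e n\<parallel>\<close> on that event. The latter is an integral of the conditional
  expectation of \<open>\<parallel>e n\<parallel>\<close>, to which Jensen's inequality for the square applies.
\<close>

lemma conditional_error_bound:
  assumes A: "A \<in> sets (past n)"
  shows "(\<integral>\<^sup>+\<omega>. ennreal (step_error n \<omega>) * indicator A \<omega> \<partial>M) \<le> (\<integral>\<^sup>+\<omega>. ennreal (predicted_error n \<omega>) * indicator A \<omega> \<partial>M)"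
proof -
  interpret F: finite_measure_subalgebra M "past n"
    by unfold_locales (rule subalgebra_past)
  let ?E = "real_cond_exp M (past n)"
  have AM[measurable]: "A \<in> sets M" using A subalgebra_past by (auto simp: subalgebra_def)
  have [measurable]: "A \<in> sets (past_and_error n)"
    using A subalgebra_joint by (auto simp: subalgebra_def)
  note [measurable] = e_measurable_joint
  have int: "integrable M (\<lambda>\<omega>. indicator A \<omega> * norm (e n \<omega>))"
    using integrable_mult_indicator[OF AM e_integrable] by simp
  have ce: "integrable M (\<lambda>\<omega>. indicator A \<omega> * ?E (\<lambda>\<omega>. norm (e n \<omega>)) \<omega>)"
    "expectation (\<lambda>\<omega>. indicator A \<omega> * ?E (\<lambda>\<omega>. norm (e n \<omega>)) \<omega>)
      = expectation (\<lambda>\<omega>. indicator A \<omega> * norm (e n \<omega>))"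
    using F.real_cond_exp_intg[OF int] A by auto
  have prod: "expectation (\<lambda>\<omega>. \<mu> n \<omega> * (indicator A \<omega> * norm (e n \<omega>)))
      = expectation (\<mu> n) * expectation (\<lambda>\<omega>. indicator A \<omega> * norm (e n \<omega>))"
    "integrable M (\<lambda>\<omega>. \<mu> n \<omega> * (indicator A \<omega> * norm (e n \<omega>)))"
    using indep_integral[of "\<lambda>t. t" n "\<lambda>\<omega>. indicator A \<omega> * norm (e n \<omega>)"] \<mu>_integrable int by auto
  have pos: "AE \<omega> in M. 0 \<le> ?E (\<lambda>\<omega>. norm (e n \<omega>)) \<omega>"
    by (rule F.real_cond_exp_pos) auto
  have "AE \<omega> in M. (?E (\<lambda>\<omega>. norm (e n \<omega>)) \<omega>)\<^sup>2 \<le> ?E (\<lambda>\<omega>. (norm (e n \<omega>))\<^sup>2) \<omega>"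
    by (rule F.real_cond_exp_jensens_inequality(2)[where I = UNIV and q = "\<lambda>t. t\<^sup>2"])
      (auto intro: e_integrable e_square_integrable convex_power2)
  then have jensen: "AE \<omega> in M. expectation (\<mu> n) * ?E (\<lambda>\<omega>. norm (e n \<omega>)) \<omega> \<le> predicted_error n \<omega>"
    unfolding predicted_error_def
    by eventually_elim (intro mult_left_mono real_le_rsqrt expectation_\<mu>_nonneg)
  have "(\<integral>\<^sup>+\<omega>. ennreal (step_error n \<omega>) * indicator A \<omega> \<partial>M)
      = (\<integral>\<^sup>+\<omega>. ennreal (\<mu> n \<omega> * (indicator A \<omega> * norm (e n \<omega>))) \<partial>M)"
    by (intro nn_integral_cong) (auto simp: step_error_def split: split_indicator)
  also have "\<dots> = ennreal (expectation (\<lambda>\<omega>. \<mu> n \<omega> * (indicator A \<omega> * norm (e n \<omega>))))"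
    using \<mu>_bounds_at[of n] by (intro nn_integral_eq_integral prod) (auto elim!: eventually_mono)
  also have "\<dots> = ennreal (expectation (\<lambda>\<omega>. expectation (\<mu> n) * (indicator A \<omega> * ?E (\<lambda>\<omega>. norm (e n \<omega>)) \<omega>)))"
    by (simp add: prod(1) ce(2))
  also have "\<dots> = (\<integral>\<^sup>+\<omega>. ennreal (expectation (\<mu> n) * (indicator A \<omega> * ?E (\<lambda>\<omega>. norm (e n \<omega>)) \<omega>)) \<partial>M)"
    using pos by (intro nn_integral_eq_integral[symmetric] integrable_mult_right ce(1))
      (auto simp: expectation_\<mu>_nonneg)
  also have "\<dots> \<le> (\<integral>\<^sup>+\<omega>. ennreal (predicted_error n \<omega>) * indicator A \<omega> \<partial>M)"
    using jensen by (intro nn_integral_mono_AE) (auto split: split_indicator intro: ennreal_leI)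
  finally show ?thesis .
qed

lemma errors_summable:
  assumes fin: "AE \<omega> in M. (\<Sum>n. ennreal (predicted_error n \<omega>)) < \<infinity>"
  shows "AE \<omega> in M. summable (\<lambda>n. step_error n \<omega>)"
proof -
  have "AE \<omega> in M. (\<Sum>n. ennreal (step_error n \<omega>)) < \<infinity>"
    by (rule AE_suminf_finite_of_conditional_bound[OF finite_measure_axioms subalgebra_past subalgebra_past_mono
          _ _ conditional_error_bound fin])
      (auto intro: measurable_compose[OF predicted_error_measurable_past measurable_ennreal])
  with step_error_nonneg show ?thesis
    by eventually_elim (auto intro: summable_suminf_not_top)
qed

text \<open>
  The one-step inequalities hold on every path with this property, and almost every path has it, so
  that no exceptional set depends on \<open>n\<close> or on the fixed point.
\<close>

definition follows_recursion :: "'w \<Rightarrow> bool" where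
  "follows_recursion \<omega> \<longleftrightarrow> (\<forall>n. 0 < \<mu> n \<omega> \<and> \<mu> n \<omega> < 1 \<and>
    x (Suc n) \<omega> = x n \<omega> + \<mu> n \<omega> *\<^sub>R (T (x n \<omega>) + e n \<omega> - x n \<omega>))"

lemma AE_follows_recursion: "AE \<omega> in M. follows_recursion \<omega>"
proof -
  have "AE \<omega> in M. \<forall>n. x (Suc n) \<omega> = x n \<omega> + \<mu> n \<omega> *\<^sub>R (T (x n \<omega>) + e n \<omega> - x n \<omega>)"
    using rec by (simp add: AE_all_countable)
  with \<mu>_bounds show ?thesis
    unfolding follows_recursion_def by eventually_elim blast
qed

context
  fixes \<omega> assumes follows_recursion: "follows_recursion \<omega>"
begin

lemma distance_step: "z \<in> Fix T \<Longrightarrow> norm (x (Suc n) \<omega> - z) \<le> norm (x n \<omega> - z) + step_error n \<omega>"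
  using KM_step_distance[OF T, of z "\<mu> n \<omega>"] follows_recursion by (simp add: follows_recursion_def step_error_def)

lemma residual_step: "residual (Suc n) \<omega> \<le> residual n \<omega> + 2 * step_error n \<omega>"
  using KM_step_residual[OF T, of "\<mu> n \<omega>"] follows_recursion by (simp add: follows_recursion_def step_error_def residual_def)

lemma energy_step:
  "z \<in> Fix T \<Longrightarrow> norm (x n \<omega> - z) \<le> R \<Longrightarrow> \<mu> n \<omega> * (1 - \<mu> n \<omega>) * (residual n \<omega>)\<^sup>2
    \<le> (norm (x n \<omega> - z))\<^sup>2 - (min (norm (x (Suc n) \<omega> - z)) R)\<^sup>2 + 2 * R * step_error n \<omega>"
  using KM_step_energy[OF T, of z "\<mu> n \<omega>"] follows_recursion by (simp add: follows_recursion_def step_error_def residual_def)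

lemma step_error_nonneg_at: "0 \<le> step_error n \<omega>"
  using follows_recursion by (simp add: follows_recursion_def step_error_def less_imp_le)

lemma distance_convergent:
  assumes "summable (\<lambda>n. step_error n \<omega>)" "z \<in> Fix T"
  shows "convergent (\<lambda>n. norm (x n \<omega> - z))"
  using distance_step[OF assms(2)] step_error_nonneg_at
  by (intro asymptotic_almost_decreasing_converges[OF _ _ assms(1)]) auto

lemma residual_convergent:
  assumes "summable (\<lambda>n. step_error n \<omega>)"
  shows "convergent (\<lambda>n. residual n \<omega>)"
  using residual_step step_error_nonneg_at summable_mult[OF assms, of 2]
  by (intro asymptotic_almost_decreasing_converges[of _ "\<lambda>n. 2 * step_error n \<omega>"]) (auto simp: residual_def)

lemma distance_le:
  assumes "z \<in> Fix T"
  shows "norm (x n \<omega> - z) \<le> norm (x 0 \<omega> - z) + (\<Sum>k<n. step_error k \<omega>)"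
proof (induction n)
  case (Suc n)
  then show ?case using distance_step[OF assms, of n] by simp
qed simp

lemma residual_le_distance:
  assumes "z \<in> Fix T" shows "residual n \<omega> \<le> 2 * norm (x n \<omega> - z)"
proof -
  have "norm (T (x n \<omega>) - z) \<le> norm (x n \<omega> - z)"
    using lipschitz_onD[OF T, of "x n \<omega>" z] assms by (simp add: dist_norm Fix_def)
  then show ?thesis
    using norm_triangle_ineq4[of "T (x n \<omega>) - z" "x n \<omega> - z"] by (simp add: residual_def)
qed

end

section \<open>Almost sure convergence\<close>

text \<open>
  Events, decreasing in \<open>n\<close> and known at time \<open>n\<close>, on which the iterates and the accumulated
  predicted errors have stayed bounded. If the predicted errors are almost surely summable, then almost
  every path stays in these events forever for some \<open>R\<close> and \<open>C\<close>.
\<close>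

definition localized :: "'a \<Rightarrow> real \<Rightarrow> real \<Rightarrow> nat \<Rightarrow> 'w set" where
  "localized z R C n = {\<omega>\<in>space M. (\<forall>j\<le>n. norm (x j \<omega> - z) \<le> R) \<and> (\<Sum>j\<le>n. ennreal (predicted_error j \<omega>)) \<le> ennreal C}"

lemma localized_sets_past: "localized z R C n \<in> sets (past n)"
proof -
  have [measurable]: "(\<lambda>\<omega>. norm (x j \<omega> - z)) \<in> borel_measurable (past n)" if "j \<le> n" for j
    using x_measurable_past[OF that] by measurable
  have "predicted_error j \<in> borel_measurable (past n)" if "j \<le> n" for j
    using measurable_from_subalg[OF subalgebra_past_mono[OF that] predicted_error_measurable_past] .
  then have [measurable]: "(\<lambda>\<omega>. \<Sum>j\<le>n. ennreal (predicted_error j \<omega>)) \<in> borel_measurable (past n)"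
    by (intro borel_measurable_sum measurable_compose[OF _ measurable_ennreal]) auto
  have sp: "space (past n) = space M" by (simp add: past_def)
  have "{\<omega>\<in>space (past n). \<forall>j\<in>{..n}. norm (x j \<omega> - z) \<le> R} \<in> sets (past n)"
    by (intro sets.sets_Collect_finite_All) auto
  moreover have "{\<omega>\<in>space (past n). (\<Sum>j\<le>n. ennreal (predicted_error j \<omega>)) \<le> ennreal C} \<in> sets (past n)"
    by measurable
  ultimately have "{\<omega>\<in>space (past n). \<forall>j\<in>{..n}. norm (x j \<omega> - z) \<le> R}
      \<inter> {\<omega>\<in>space (past n). (\<Sum>j\<le>n. ennreal (predicted_error j \<omega>)) \<le> ennreal C} \<in> sets (past n)"
    by (rule sets.Int)
  also have "{\<omega>\<in>space (past n). \<forall>j\<in>{..n}. norm (x j \<omega> - z) \<le> R}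
      \<inter> {\<omega>\<in>space (past n). (\<Sum>j\<le>n. ennreal (predicted_error j \<omega>)) \<le> ennreal C} = localized z R C n"
    by (auto simp: localized_def sp)
  finally show ?thesis .
qed

lemma localized_sets [measurable]: "localized z R C n \<in> sets M"
  using localized_sets_past[of z R C n] subalgebra_past[of n] by (auto simp: subalgebra_def)

lemma localized_mono: "localized z R C (Suc n) \<subseteq> localized z R C n"
  by (auto simp: localized_def intro: order_trans[rotated])

lemma localized_distance: "\<omega> \<in> localized z R C n \<Longrightarrow> norm (x n \<omega> - z) \<le> R"
  by (auto simp: localized_def)

lemma truncated_error_sum:
  assumes "0 \<le> C"
  shows "(\<Sum>k<n. expectation (\<lambda>\<omega>. step_error k \<omega> * indicator (localized z R C k) \<omega>)) \<le> C"
proof -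
  define S where "S k = {\<omega>\<in>space M. (\<Sum>j\<le>k. ennreal (predicted_error j \<omega>)) \<le> ennreal C}" for k
  have int: "integrable M (\<lambda>\<omega>. step_error k \<omega> * indicator (localized z R C k) \<omega>)" for k
    by (rule integrable_real_mult_indicator[OF localized_sets step_error_integrable])
  have nn: "AE \<omega> in M. 0 \<le> step_error k \<omega> * indicator (localized z R C k) \<omega>" for k
    using step_error_nonneg by eventually_elim simp
  have "ennreal (\<Sum>k<n. expectation (\<lambda>\<omega>. step_error k \<omega> * indicator (localized z R C k) \<omega>))
      = (\<Sum>k<n. ennreal (expectation (\<lambda>\<omega>. step_error k \<omega> * indicator (localized z R C k) \<omega>)))"
    using nn by (intro sum_ennreal[symmetric] integral_nonneg_AE) auto
  also have "\<dots> = (\<Sum>k<n. \<integral>\<^sup>+\<omega>. ennreal (step_error k \<omega> * indicator (localized z R C k) \<omega>) \<partial>M)"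
    by (intro sum.cong refl nn_integral_eq_integral[symmetric] int nn)
  also have "\<dots> \<le> (\<Sum>k<n. \<integral>\<^sup>+\<omega>. ennreal (step_error k \<omega>) * indicator (S k) \<omega> \<partial>M)"
    by (intro sum_mono nn_integral_mono) (auto simp: localized_def S_def split: split_indicator)
  also have "\<dots> \<le> (\<Sum>k. \<integral>\<^sup>+\<omega>. ennreal (step_error k \<omega>) * indicator (S k) \<omega> \<partial>M)"
    by (intro sum_le_suminf summableI) auto
  also have "\<dots> \<le> ennreal C * emeasure M (space M)"
    unfolding S_def
    by (rule nn_integral_truncated_sum_le[OF subalgebra_past subalgebra_past_mono _ _ conditional_error_bound])
      (auto intro: measurable_compose[OF predicted_error_measurable_past measurable_ennreal])
  finally show ?thesis
    using assms by (simp add: emeasure_space_1 ennreal_le_iff)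
qed

lemma residual_square_localized:
  assumes z: "z \<in> Fix T"
  shows "AE \<omega> in M. (residual n \<omega>)\<^sup>2 * indicator (localized z R C n) \<omega> \<le> (2 * R)\<^sup>2"
  using AE_follows_recursion
proof eventually_elim
  case (elim \<omega>)
  show ?case
  proof (cases "\<omega> \<in> localized z R C n")
    case True
    have "residual n \<omega> \<le> 2 * R"
      using residual_le_distance[OF elim z, of n] localized_distance[OF True] by simp
    then have "(residual n \<omega>)\<^sup>2 \<le> (2 * R)\<^sup>2" by (intro power_mono) (auto simp: residual_def)
    then show ?thesis using True by simp
  qed simp
qed

text \<open>
  Integrate the energy inequality over \<open>localized z R C n\<close>. The left-hand side factors, as \<open>\<mu> n\<close> is
  independent of the past. On the right-hand side the squared distances telescope: shrinking the
  event from time \<open>n\<close> to time \<open>n + 1\<close> only discards nonnegative terms, and on the smaller event the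
  cut-off at \<open>R\<close> is inactive. What remains is bounded by \<open>R\<^sup>2 + 2 R C\<close>.
\<close>

lemma residual_energy_finite:
  assumes z: "z \<in> Fix T" and R: "0 \<le> R" and C: "0 \<le> C"
  shows "AE \<omega> in M. (\<forall>n. \<omega> \<in> localized z R C n) \<longrightarrow> (\<Sum>n. ennreal (weight n * (residual n \<omega>)\<^sup>2)) < \<infinity>"
proof -
  define A where "A = localized z R C"
  have [measurable]: "A n \<in> sets M" for n unfolding A_def by measurable
  define D where "D n \<omega> = (residual n \<omega>)\<^sup>2 * indicator (A n) \<omega>" for n \<omega>
  define a where "a n = expectation (\<lambda>\<omega>. (norm (x n \<omega> - z))\<^sup>2 * indicator (A n) \<omega>)" for n
  define a' where "a' n = expectation (\<lambda>\<omega>. (min (norm (x (Suc n) \<omega> - z)) R)\<^sup>2 * indicator (A n) \<omega>)" for n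
  define \<beta> where "\<beta> n = expectation (\<lambda>\<omega>. step_error n \<omega> * indicator (A n) \<omega>)" for n
  have [measurable]: "D n \<in> borel_measurable M" for n unfolding D_def by measurable
  have D_int: "integrable M (D n)" for n
    using residual_square_localized[OF z, of n R C]
    by (intro integrable_const_bound[of _ "(2 * R)\<^sup>2"]) (auto simp: D_def A_def)
  have D_joint: "D n \<in> borel_measurable (past_and_error n)" for n
  proof -
    have [measurable]: "A n \<in> sets (past_and_error n)" "x n \<in> borel_measurable (past_and_error n)"
      using localized_sets_past[of z R C n] x_measurable_past[OF order_refl, of n] subalgebra_joint[of n]
        measurable_from_subalg by (auto simp: subalgebra_def A_def)
    show ?thesis unfolding D_def residual_def by measurable
  qed
  have wD: "expectation (\<lambda>\<omega>. \<mu> n \<omega> * (1 - \<mu> n \<omega>) * D n \<omega>) = weight n * expectation (D n)"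
    "integrable M (\<lambda>\<omega>. \<mu> n \<omega> * (1 - \<mu> n \<omega>) * D n \<omega>)" for n
    using indep_integral[of "\<lambda>t. t * (1 - t)" n "D n"] weight_integrable D_int D_joint
    by (auto simp: weight_def)
  have dist_int: "integrable M (\<lambda>\<omega>. (norm (x n \<omega> - z))\<^sup>2 * indicator (A n) \<omega>)" for n
    using R by (intro integrable_const_bound[of _ "R\<^sup>2"])
      (auto simp: A_def dest: localized_distance intro: power_mono split: split_indicator)
  have min_int: "integrable M (\<lambda>\<omega>. (min (norm (x (Suc n) \<omega> - z)) R)\<^sup>2 * indicator (A n) \<omega>)" for n
    using R by (intro integrable_const_bound[of _ "R\<^sup>2"])
      (auto intro: power_mono split: split_indicator)
  have b_int: "integrable M (\<lambda>\<omega>. step_error n \<omega> * indicator (A n) \<omega>)" for n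
    unfolding A_def by (rule integrable_real_mult_indicator[OF localized_sets step_error_integrable])
  have step: "weight n * expectation (D n) \<le> a n - a' n + 2 * R * \<beta> n" for n
  proof -
    have "weight n * expectation (D n) = expectation (\<lambda>\<omega>. \<mu> n \<omega> * (1 - \<mu> n \<omega>) * D n \<omega>)"
      by (simp add: wD)
    also have "\<dots> \<le> expectation (\<lambda>\<omega>. (norm (x n \<omega> - z))\<^sup>2 * indicator (A n) \<omega>
        - (min (norm (x (Suc n) \<omega> - z)) R)\<^sup>2 * indicator (A n) \<omega>
        + 2 * R * (step_error n \<omega> * indicator (A n) \<omega>))"
    proof (intro integral_mono_AE wD Bochner_Integration.integrable_add
        Bochner_Integration.integrable_diff dist_int min_int integrable_mult_right b_int)
      show "AE \<omega> in M. \<mu> n \<omega> * (1 - \<mu> n \<omega>) * D n \<omega> \<le> (norm (x n \<omega> - z))\<^sup>2 * indicator (A n) \<omega>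
        - (min (norm (x (Suc n) \<omega> - z)) R)\<^sup>2 * indicator (A n) \<omega>
        + 2 * R * (step_error n \<omega> * indicator (A n) \<omega>)"
        using AE_follows_recursion
      proof eventually_elim
        case (elim \<omega>)
        show ?case
          using energy_step[OF elim z, of n R] localized_distance[of \<omega> z R C n]
          by (auto simp: D_def A_def split: split_indicator)
      qed
    qed
    also have "\<dots> = a n - a' n + 2 * R * \<beta> n"
      unfolding a_def a'_def \<beta>_def using dist_int min_int b_int by simp
    finally show ?thesis .
  qed
  have a_step: "a (Suc n) \<le> a' n" for n
    unfolding a_def a'_def
  proof (rule integral_mono[OF dist_int min_int])
    fix \<omega> assume "\<omega> \<in> space M"
    show "(norm (x (Suc n) \<omega> - z))\<^sup>2 * indicator (A (Suc n)) \<omega>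
      \<le> (min (norm (x (Suc n) \<omega> - z)) R)\<^sup>2 * indicator (A n) \<omega>"
      using localized_mono[of z R C n] localized_distance[of \<omega> z R C "Suc n"]
      by (auto simp: A_def min_absorb1 split: split_indicator)
  qed
  have a_nonneg: "0 \<le> a n" for n unfolding a_def by simp
  have a0: "a 0 \<le> R\<^sup>2"
    unfolding a_def
  proof (rule integral_le_const[OF dist_int])
    show "AE \<omega> in M. (norm (x 0 \<omega> - z))\<^sup>2 * indicator (A 0) \<omega> \<le> R\<^sup>2"
      using R by (auto simp: A_def dest: localized_distance intro: power_mono split: split_indicator)
  qed
  have "(\<Sum>k<n. weight k * expectation (D k)) \<le> a 0 - a n + 2 * R * (\<Sum>k<n. \<beta> k)" for n
  proof (induction n)
    case (Suc n)
    then show ?case using step[of n] a_step[of n] by (simp add: distrib_left)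
  qed simp
  moreover have "2 * R * (\<Sum>k<n. \<beta> k) \<le> 2 * R * C" for n
    using truncated_error_sum[OF C, of z R n] R unfolding \<beta>_def A_def by (intro mult_left_mono) auto
  ultimately have sum_le: "(\<Sum>k<n. weight k * expectation (D k)) \<le> R\<^sup>2 + 2 * R * C" for n
    using a0 a_nonneg by (smt (verit))
  have wD_nonneg: "0 \<le> weight n * expectation (D n)" for n
    by (intro mult_nonneg_nonneg weight_nonneg integral_nonneg) (simp add: D_def)
  have "(\<integral>\<^sup>+\<omega>. (\<Sum>n. ennreal (weight n * D n \<omega>)) \<partial>M) = (\<Sum>n. \<integral>\<^sup>+\<omega>. ennreal (weight n * D n \<omega>) \<partial>M)"
    by (rule nn_integral_suminf) measurable
  also have "\<dots> = (\<Sum>n. ennreal (weight n * expectation (D n)))"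
  proof (rule suminf_cong)
    fix n
    have "(\<integral>\<^sup>+\<omega>. ennreal (weight n * D n \<omega>) \<partial>M) = ennreal (expectation (\<lambda>\<omega>. weight n * D n \<omega>))"
      by (intro nn_integral_eq_integral integrable_mult_right D_int) (simp add: D_def weight_nonneg)
    then show "(\<integral>\<^sup>+\<omega>. ennreal (weight n * D n \<omega>) \<partial>M) = ennreal (weight n * expectation (D n))" by simp
  qed
  also have "\<dots> \<le> ennreal (R\<^sup>2 + 2 * R * C)"
    using sum_le wD_nonneg by (intro suminf_le_const summableI) (simp add: sum_ennreal ennreal_leI)
  finally have "(\<integral>\<^sup>+\<omega>. (\<Sum>n. ennreal (weight n * D n \<omega>)) \<partial>M) \<noteq> \<infinity>"
    by (auto simp: top_unique)
  then have "AE \<omega> in M. (\<Sum>n. ennreal (weight n * D n \<omega>)) \<noteq> \<infinity>"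
    by (intro nn_integral_noteq_infinite) auto
  then show ?thesis
    by eventually_elim (auto simp: D_def A_def less_top)
qed

text \<open>
  On almost every path the residual converges and its squares have a finite sum with respect to
  weights of infinite total mass, so its limit is zero.
\<close>

theorem residual_tendsto_zero:
  assumes fin: "AE \<omega> in M. (\<Sum>n. ennreal (predicted_error n \<omega>)) < \<infinity>"
  shows "AE \<omega> in M. (\<lambda>n. T (x n \<omega>) - x n \<omega>) \<longlonglongrightarrow> 0"
proof -
  obtain z where z: "z \<in> Fix T" using Fix_ne by blast
  have "AE \<omega> in M. \<forall>R C :: nat. (\<forall>n. \<omega> \<in> localized z (real R) (real C) n)
      \<longrightarrow> (\<Sum>n. ennreal (weight n * (residual n \<omega>)\<^sup>2)) < \<infinity>"
    unfolding AE_all_countable using residual_energy_finite[OF z] by simp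
  with fin errors_summable[OF fin] AE_follows_recursion AE_space show ?thesis
  proof eventually_elim
    case (elim \<omega>)
    obtain K where "\<And>n. norm (norm (x n \<omega> - z)) \<le> K"
      using convergent_imp_Bseq[OF distance_convergent[OF elim(3,2) z]] by (auto simp: Bseq_def)
    moreover obtain R :: nat where "K \<le> real R" using real_arch_simple by blast
    ultimately have R: "norm (x n \<omega> - z) \<le> real R" for n by (force intro: order_trans)
    obtain C :: nat where C: "(\<Sum>n. ennreal (predicted_error n \<omega>)) < of_nat C"
      using ennreal_Ex_less_of_nat elim(1) by fastforce
    have "\<omega> \<in> localized z (real R) (real C) n" for n
    proof -
      have "(\<Sum>j\<le>n. ennreal (predicted_error j \<omega>)) \<le> (\<Sum>j. ennreal (predicted_error j \<omega>))"
        by (intro sum_le_suminf summableI) auto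
      also have "\<dots> \<le> ennreal (real C)" using C by (simp add: ennreal_of_nat_eq_real_of_nat)
      finally show ?thesis using R elim by (simp add: localized_def)
    qed
    with elim have "(\<Sum>n. ennreal (weight n * (residual n \<omega>)\<^sup>2)) < \<infinity>" by blast
    then have "(\<lambda>n. residual n \<omega>) \<longlonglongrightarrow> 0"
      using divergent by (intro convergent_vanishes_of_weighted_sum[of weight] weight_nonneg
          residual_convergent[OF elim(3,2)]) (auto simp: weight_def)
    then show ?case by (simp add: residual_def tendsto_norm_zero_iff)
  qed
qed

theorem weakly_convergent:
  assumes fin: "AE \<omega> in M. (\<Sum>n. ennreal (predicted_error n \<omega>)) < \<infinity>"
  shows "AE \<omega> in M. \<exists>z\<in>Fix T. weakly_converges (\<lambda>n. x n \<omega>) z"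
  using errors_summable[OF fin] residual_tendsto_zero[OF fin] AE_follows_recursion
proof eventually_elim
  case (elim \<omega>)
  then show ?case
    by (intro Fejer_weakly_converges[OF T Fix_ne] distance_convergent)
qed

text \<open>
  The limit is chosen path by path, with an arbitrary fixed point where weak convergence fails. Its
  inner product with each vector is almost everywhere a limit of measurable functions; completeness of
  the measure and weak measurability then make the choice measurable.
\<close>

theorem weak_limit_exists:
  assumes fin: "AE \<omega> in M. (\<Sum>n. ennreal (predicted_error n \<omega>)) < \<infinity>"
  obtains y where "y \<in> borel_measurable M" "\<And>\<omega>. y \<omega> \<in> Fix T"
    "AE \<omega> in M. weakly_converges (\<lambda>n. x n \<omega>) (y \<omega>)"
proof -
  have "\<exists>u. u \<in> Fix T \<and> ((\<exists>z\<in>Fix T. weakly_converges (\<lambda>n. x n \<omega>) z) \<longrightarrow> weakly_converges (\<lambda>n. x n \<omega>) u)" for \<omega>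
    using Fix_ne by blast
  then obtain y where y: "\<And>\<omega>. y \<omega> \<in> Fix T"
    "\<And>\<omega>. (\<exists>z\<in>Fix T. weakly_converges (\<lambda>n. x n \<omega>) z) \<Longrightarrow> weakly_converges (\<lambda>n. x n \<omega>) (y \<omega>)"
    by metis
  have weak: "AE \<omega> in M. weakly_converges (\<lambda>n. x n \<omega>) (y \<omega>)"
    using weakly_convergent[OF fin] by eventually_elim (rule y(2))
  have "y \<in> borel_measurable M"
  proof (rule borel_measurable_weakly)
    fix u
    have "AE \<omega> in M. y \<omega> \<bullet> u = lim (\<lambda>n. x n \<omega> \<bullet> u)"
      using weak by eventually_elim (auto simp: weakly_converges_def intro: limI[symmetric])
    then show "(\<lambda>\<omega>. y \<omega> \<bullet> u) \<in> borel_measurable M"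
      by (rule borel_measurable_AE_eq[rotated]) measurable
  qed
  with y(1) weak that show thesis by blast
qed

section \<open>Square integrability\<close>

text \<open>
  By independence, this is the \<open>L\<^sup>2\<close> norm of \<open>step_error n\<close>.
\<close>

definition error_norm :: "nat \<Rightarrow> real" where
  "error_norm n = sqrt (expectation (\<lambda>\<omega>. (\<mu> n \<omega>)\<^sup>2) * expectation (\<lambda>\<omega>. (norm (e n \<omega>))\<^sup>2))"

text \<open>
  Since \<open>E \<mu>\<^sub>n \<le> \<surd>E \<mu>\<^sub>n\<^sup>2\<close>, and the square root of the conditional expectation of \<open>\<parallel>e\<^sub>n\<parallel>\<^sup>2\<close> has
  expectation at most \<open>\<surd>E \<parallel>e\<^sub>n\<parallel>\<^sup>2\<close>, the expectation of \<open>predicted_error n\<close> is at most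
  \<open>error_norm n\<close>.
\<close>

lemma conditional_sum_finite:
  assumes fin: "(\<Sum>n. ennreal (error_norm n)) < \<infinity>"
  shows "AE \<omega> in M. (\<Sum>n. ennreal (predicted_error n \<omega>)) < \<infinity>"
proof -
  have c_le: "(\<integral>\<^sup>+\<omega>. ennreal (predicted_error n \<omega>) \<partial>M) \<le> ennreal (error_norm n)" for n
  proof -
    interpret F: finite_measure_subalgebra M "past n"
      by unfold_locales (rule subalgebra_past)
    define r where "r = real_cond_exp M (past n) (\<lambda>\<omega>. (norm (e n \<omega>))\<^sup>2)"
    have [measurable]: "r \<in> borel_measurable M" unfolding r_def by simp
    have r_pos: "AE \<omega> in M. 0 \<le> r \<omega>"
      unfolding r_def by (rule F.real_cond_exp_pos) auto
    have r_int: "integrable M r" "expectation r = expectation (\<lambda>\<omega>. (norm (e n \<omega>))\<^sup>2)"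
      unfolding r_def using F.real_cond_exp_int[OF e_square_integrable] by auto
    have sq: "AE \<omega> in M. (sqrt (r \<omega>))\<^sup>2 = r \<omega>" using r_pos by eventually_elim simp
    have sq_int: "integrable M (\<lambda>\<omega>. (sqrt (r \<omega>))\<^sup>2)"
      using r_int(1) by (rule integrable_cong_AE_imp) (use sq in \<open>auto elim: eventually_mono\<close>)
    have "expectation (\<lambda>\<omega>. (sqrt (r \<omega>))\<^sup>2) = expectation r"
      using sq by (intro integral_cong_AE) auto
    then have sqrt_le: "expectation (\<lambda>\<omega>. sqrt (r \<omega>)) \<le> sqrt (expectation (\<lambda>\<omega>. (norm (e n \<omega>))\<^sup>2))"
      using expectation_le_sqrt[of "\<lambda>\<omega>. sqrt (r \<omega>)"] sq_int r_int(2) by simp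
    have sqrt_int: "integrable M (\<lambda>\<omega>. sqrt (r \<omega>))"
      by (rule square_integrable_imp_integrable[OF _ sq_int]) measurable
    have sqrt_nonneg: "0 \<le> expectation (\<lambda>\<omega>. sqrt (r \<omega>))"
      using r_pos by (intro integral_nonneg_AE) (auto elim: eventually_mono)
    have "(\<integral>\<^sup>+\<omega>. ennreal (predicted_error n \<omega>) \<partial>M) = ennreal (expectation (\<lambda>\<omega>. expectation (\<mu> n) * sqrt (r \<omega>)))"
      unfolding predicted_error_def r_def[symmetric]
      using r_pos expectation_\<mu>_nonneg
      by (intro nn_integral_eq_integral integrable_mult_right sqrt_int) (auto elim: eventually_mono)
    also have "\<dots> = ennreal (expectation (\<mu> n) * expectation (\<lambda>\<omega>. sqrt (r \<omega>)))" by simp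
    also have "\<dots> \<le> ennreal (error_norm n)"
      unfolding error_norm_def real_sqrt_mult
      using expectation_le_sqrt[OF \<mu>_measurable \<mu>_integrable2] sqrt_nonneg
      by (intro ennreal_leI mult_mono sqrt_le) auto
    finally show ?thesis .
  qed
  have "(\<integral>\<^sup>+\<omega>. (\<Sum>n. ennreal (predicted_error n \<omega>)) \<partial>M) = (\<Sum>n. \<integral>\<^sup>+\<omega>. ennreal (predicted_error n \<omega>) \<partial>M)"
    by (rule nn_integral_suminf) measurable
  also have "\<dots> \<le> (\<Sum>n. ennreal (error_norm n))"
    by (intro suminf_le summableI c_le)
  also have "\<dots> < \<infinity>" by (rule fin)
  finally have "AE \<omega> in M. (\<Sum>n. ennreal (predicted_error n \<omega>)) \<noteq> \<infinity>"
    by (intro nn_integral_noteq_infinite) auto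
  then show ?thesis by (simp add: less_top)
qed

text \<open>
  Iterating the one-step bound gives \<open>\<parallel>x n - z\<parallel> \<le> \<parallel>x 0 - z\<parallel> + \<Sum>step_error\<close> for all \<open>n\<close>, and the sum of
  the errors is square integrable by Minkowski's inequality. The residual is at most twice the distance
  to \<open>z\<close>.
\<close>

lemma square_integrable_envelope:
  assumes fin: "(\<Sum>n. ennreal (error_norm n)) < \<infinity>"
  obtains h where "h \<in> borel_measurable M" "integrable M (\<lambda>\<omega>. (h \<omega>)\<^sup>2)"
    "AE \<omega> in M. \<forall>n. norm (x n \<omega>) \<le> h \<omega> \<and> norm (T (x n \<omega>) - x n \<omega>) \<le> 2 * h \<omega>"
proof -
  obtain z where z: "z \<in> Fix T" using Fix_ne by blast
  define S where "S \<omega> = (\<Sum>n. ennreal (step_error n \<omega>))" for \<omega>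
  define B where "B \<omega> = enn2real (S \<omega>)" for \<omega>
  have [measurable]: "S \<in> borel_measurable M" unfolding S_def by measurable
  have [measurable]: "B \<in> borel_measurable M" unfolding B_def by measurable
  have b2: "(\<integral>\<^sup>+\<omega>. (ennreal (step_error n \<omega>))\<^sup>2 \<partial>M) \<le> (ennreal (error_norm n))\<^sup>2" for n
  proof -
    have "(\<integral>\<^sup>+\<omega>. (ennreal (step_error n \<omega>))\<^sup>2 \<partial>M) = (\<integral>\<^sup>+\<omega>. ennreal ((step_error n \<omega>)\<^sup>2) \<partial>M)"
      using step_error_nonneg by (intro nn_integral_cong_AE) (auto elim!: eventually_mono simp: ennreal_power)
    also have "\<dots> = ennreal (expectation (\<lambda>\<omega>. (step_error n \<omega>)\<^sup>2))"
      by (intro nn_integral_eq_integral step_error_square) simp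
    also have "\<dots> = (ennreal (error_norm n))\<^sup>2"
      by (simp add: step_error_square(1) error_norm_def ennreal_power)
    finally show ?thesis by simp
  qed
  have B2: "integrable M (\<lambda>\<omega>. (B \<omega>)\<^sup>2)"
  proof (rule integrableI_bounded)
    have "(\<integral>\<^sup>+\<omega>. ennreal (norm ((B \<omega>)\<^sup>2)) \<partial>M) \<le> (\<integral>\<^sup>+\<omega>. (S \<omega>)\<^sup>2 \<partial>M)"
    proof (rule nn_integral_mono)
      fix \<omega>
      have "ennreal (norm ((B \<omega>)\<^sup>2)) = (ennreal (B \<omega>))\<^sup>2" by (simp add: B_def ennreal_power)
      also have "\<dots> \<le> (S \<omega>)\<^sup>2"
        unfolding B_def by (intro power_mono) (cases "S \<omega>", auto)
      finally show "ennreal (norm ((B \<omega>)\<^sup>2)) \<le> (S \<omega>)\<^sup>2" .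
    qed
    also have "\<dots> \<le> (\<Sum>n. ennreal (error_norm n))\<^sup>2"
      unfolding S_def by (rule nn_integral_suminf_power2_le[OF _ b2]) measurable
    also have "\<dots> < \<infinity>"
      using fin by (simp add: power2_eq_square ennreal_mult_less_top)
    finally show "(\<integral>\<^sup>+\<omega>. ennreal (norm ((B \<omega>)\<^sup>2)) \<partial>M) < \<infinity>" .
  qed measurable
  define k where "k \<omega> = norm (x 0 \<omega>) + 2 * norm z" for \<omega>
  have [measurable]: "k \<in> borel_measurable M" unfolding k_def by measurable
  have x0: "integrable M (\<lambda>\<omega>. (norm (x 0 \<omega>))\<^sup>2)"
    using x0_L2 by (simp add: Lp_space_def)
  have k2: "integrable M (\<lambda>\<omega>. (k \<omega>)\<^sup>2)"
    by (rule square_integrable_bound[where g = "\<lambda>\<omega>. norm (x 0 \<omega>)" and h = "\<lambda>_. 2 * norm z"])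
      (auto simp: k_def x0)
  show thesis
  proof (rule that[of "\<lambda>\<omega>. k \<omega> + B \<omega>"])
    show "(\<lambda>\<omega>. k \<omega> + B \<omega>) \<in> borel_measurable M" by measurable
    show "integrable M (\<lambda>\<omega>. (k \<omega> + B \<omega>)\<^sup>2)"
      by (rule square_integrable_bound[OF _ k2 B2]) (auto simp: k_def B_def)
    show "AE \<omega> in M. \<forall>n. norm (x n \<omega>) \<le> k \<omega> + B \<omega> \<and> norm (T (x n \<omega>) - x n \<omega>) \<le> 2 * (k \<omega> + B \<omega>)"
      using AE_follows_recursion errors_summable[OF conditional_sum_finite[OF fin]]
    proof eventually_elim
      case (elim \<omega>)
      have B: "B \<omega> = (\<Sum>n. step_error n \<omega>)"
        unfolding B_def S_def using elim step_error_nonneg_at[OF elim(1)]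
        by (simp add: suminf_ennreal2 suminf_nonneg)
      show ?case
      proof
        fix n
        have "norm (x n \<omega> - z) \<le> norm (x 0 \<omega> - z) + (\<Sum>k<n. step_error k \<omega>)"
          by (rule distance_le[OF elim(1) z])
        also have "(\<Sum>k<n. step_error k \<omega>) \<le> B \<omega>"
          unfolding B using elim step_error_nonneg_at[OF elim(1)] by (intro sum_le_suminf) auto
        also have "norm (x 0 \<omega> - z) \<le> norm (x 0 \<omega>) + norm z" by (rule norm_triangle_ineq4)
        finally have "norm (x n \<omega> - z) \<le> norm (x 0 \<omega>) + norm z + B \<omega>" by simp
        moreover have "norm (x n \<omega>) \<le> norm (x n \<omega> - z) + norm z"
          using norm_triangle_ineq[of "x n \<omega> - z" z] by simp
        ultimately show "norm (x n \<omega>) \<le> k \<omega> + B \<omega> \<and> norm (T (x n \<omega>) - x n \<omega>) \<le> 2 * (k \<omega> + B \<omega>)"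
          using residual_le_distance[OF elim(1) z, of n] norm_ge_zero[of z] unfolding k_def residual_def
          by (smt (verit))
      qed
    qed
  qed
qed

end

section \<open>The convergence theorem\<close>

theorem theorem4p1:
  fixes M :: "'w measure"
    and T :: "'a::{real_inner, banach, second_countable_topology} \<Rightarrow> 'a"
    and x e :: "nat \<Rightarrow> 'w \<Rightarrow> 'a"
    and \<mu> :: "nat \<Rightarrow> 'w \<Rightarrow> real"
  assumes "prob_space M" and "complete_measure M"
    and "1-lipschitz_on UNIV T" and "Fix T \<noteq> {}"
    and "x 0 \<in> Lp_space M 2 UNIV"
    and "\<And>n. e n \<in> Lp_space M 2 UNIV"
    and "\<And>n. \<mu> n \<in> Linf_space M {0<..<1}"
    and "\<And>n. AE \<omega> in M. x (Suc n) \<omega> = x n \<omega> + \<mu> n \<omega> *\<^sub>R (T (x n \<omega>) + e n \<omega> - x n \<omega>)"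
    and "(\<Sum>n. ennreal (\<integral>\<omega>. \<mu> n \<omega> * (1 - \<mu> n \<omega>) \<partial>M)) = \<infinity>"
    and "\<And>n. prob_space.indep_set M (sets (sigma_rv M {\<mu> n}))
                 (sets (sigma_rv M ({e n} \<union> x ` {..n})))"
  shows "\<exists>y. y \<in> borel_measurable M \<and> (\<forall>\<omega>\<in>space M. y \<omega> \<in> Fix T) \<and>
    ((AE \<omega> in M. (\<lambda>n. real_cond_exp M (sigma_rv M (x ` {..n})) (\<lambda>\<omega>. (norm (e n \<omega>))\<^sup>2) \<omega>)
          \<longlonglongrightarrow> 0) \<and>
     (AE \<omega> in M. (\<Sum>n. ennreal ((\<integral>\<omega>. \<mu> n \<omega> \<partial>M) *
          sqrt (real_cond_exp M (sigma_rv M (x ` {..n})) (\<lambda>\<omega>. (norm (e n \<omega>))\<^sup>2) \<omega>))) < \<infinity>)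
     \<longrightarrow>
       (AE \<omega> in M. (\<lambda>n. T (x n \<omega>) - x n \<omega>) \<longlonglongrightarrow> 0) \<and>
       (AE \<omega> in M. weakly_converges (\<lambda>n. x n \<omega>) (y \<omega>)) \<and>
       ((\<forall>z\<in>Fix T. demiregular_at (\<lambda>u. T u - u) z) \<longrightarrow>
          (AE \<omega> in M. (\<lambda>n. x n \<omega>) \<longlonglongrightarrow> y \<omega>)))
    \<and>
    ((\<lambda>n. \<integral>\<omega>. (norm (e n \<omega>))\<^sup>2 \<partial>M) \<longlonglongrightarrow> 0 \<and>
     (\<Sum>n. ennreal (sqrt ((\<integral>\<omega>. (\<mu> n \<omega>)\<^sup>2 \<partial>M) * (\<integral>\<omega>. (norm (e n \<omega>))\<^sup>2 \<partial>M)))) < \<infinity>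
     \<longrightarrow>
       (Lp_converges M 1 (\<lambda>n \<omega>. T (x n \<omega>) - x n \<omega>) (\<lambda>_. 0) \<and>
        (AE \<omega> in M. (\<lambda>n. T (x n \<omega>) - x n \<omega>) \<longlonglongrightarrow> 0)) \<and>
       (y \<in> Lp_space M 2 (Fix T) \<and> L2_weakly_converges M x y \<and>
        (AE \<omega> in M. weakly_converges (\<lambda>n. x n \<omega>) (y \<omega>))) \<and>
       ((\<forall>z\<in>Fix T. demiregular_at (\<lambda>u. T u - u) z) \<longrightarrow>
          Lp_converges M 1 x y \<and> (AE \<omega> in M. (\<lambda>n. x n \<omega>) \<longlonglongrightarrow> y \<omega>)))"
proof -
  interpret random_KM M T x e \<mu>
    using assms by (intro random_KM.intro random_KM_axioms.intro)
  let ?H = "AE \<omega> in M. (\<Sum>n. ennreal (predicted_error n \<omega>)) < \<infinity>"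
  show ?thesis
  proof (cases ?H)
    case False
    \<comment> \<open>both families of hypotheses imply \<open>?H\<close>, so the constant function at any fixed point is a witness\<close>
    obtain z where "z \<in> Fix T" using Fix_ne by blast
    then show ?thesis
      using False conditional_sum_finite
      unfolding predicted_error_def past_def error_norm_def by (intro exI[of _ "\<lambda>_. z"]) auto
  next
    case True
    obtain y where y: "y \<in> borel_measurable M" "\<And>\<omega>. y \<omega> \<in> Fix T"
      "AE \<omega> in M. weakly_converges (\<lambda>n. x n \<omega>) (y \<omega>)"
      using weak_limit_exists[OF True] by blast
    note res = residual_tendsto_zero[OF True]
    have strong: "AE \<omega> in M. (\<lambda>n. x n \<omega>) \<longlonglongrightarrow> y \<omega>"
      if dem: "\<forall>z\<in>Fix T. demiregular_at (\<lambda>u. T u - u) z"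
      using y(3) res
    proof eventually_elim
      case (elim \<omega>)
      moreover have "T (y \<omega>) = y \<omega>" using y(2) by (simp add: Fix_def)
      ultimately show ?case
        using dem y(2) unfolding demiregular_at_def by simp
    qed
    have L2: "Lp_converges M 1 (\<lambda>n \<omega>. T (x n \<omega>) - x n \<omega>) (\<lambda>_. 0) \<and>
        y \<in> Lp_space M 2 (Fix T) \<and> L2_weakly_converges M x y \<and>
        ((\<forall>z\<in>Fix T. demiregular_at (\<lambda>u. T u - u) z) \<longrightarrow> Lp_converges M 1 x y)"
      if fin: "(\<Sum>n. ennreal (error_norm n)) < \<infinity>"
    proof -
      obtain h where h: "h \<in> borel_measurable M" "integrable M (\<lambda>\<omega>. (h \<omega>)\<^sup>2)"
        "AE \<omega> in M. \<forall>n. norm (x n \<omega>) \<le> h \<omega> \<and> norm (T (x n \<omega>) - x n \<omega>) \<le> 2 * h \<omega>"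
        using square_integrable_envelope[OF fin] by blast
      have h_int: "integrable M h" by (rule square_integrable_imp_integrable[OF h(1,2)])
      have h_x: "AE \<omega> in M. \<forall>n. norm (x n \<omega>) \<le> h \<omega>"
        and h_T: "AE \<omega> in M. \<forall>n. norm (T (x n \<omega>) - x n \<omega>) \<le> 2 * h \<omega>"
        using h(3) by (auto elim: eventually_mono)
      have "AE \<omega> in M. norm (y \<omega>) \<le> h \<omega>"
        using y(3) h_x by eventually_elim (rule weak_limit_norm_le, auto)
      then have "y \<in> Lp_space M 2 (Fix T)"
        using y(2) by (intro Lp_space_2I[OF y(1) h(2)]) auto
      moreover have "Lp_converges M 1 (\<lambda>n \<omega>. T (x n \<omega>) - x n \<omega>) (\<lambda>_. 0)"
        using h_int h_T res by (intro Lp_converges_1_dominated[where h = "\<lambda>\<omega>. 2 * h \<omega>"]) auto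
      moreover have "L2_weakly_converges M x y"
        using y h h_x by (intro L2_weakly_converges_dominated[where h = h]) auto
      moreover have "Lp_converges M 1 x y" if "\<forall>z\<in>Fix T. demiregular_at (\<lambda>u. T u - u) z"
        using h_int h_x strong[OF that] y by (intro Lp_converges_1_dominated[where h = h]) auto
      ultimately show ?thesis by blast
    qed
    show ?thesis
      using y res strong L2[unfolded error_norm_def] by (intro exI[of _ y]) blast
  qed
qed

end
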